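(* Let $\mathcal{G}=(B,\psi,A)$ be a real tracial quantum graph. Then $\mathcal{G}$ is bipartite if and only if it is $loc$-$2$ colorable.
   Context: A quantum set is a pair $(B,\psi)$ where $B$ is a finite-dimensional $C^*$-algebra with multiplication $m:B\otimes B\to B$, and $\psi$ is a faithful state on $B$ that is a $\delta$-form, i.e. $mm^\dagger=\delta^2\,\mathrm{id}_B$ for some $\delta\ge 0$. Here $B$ is regarded as the Hilbert space $L^2(B,\psi)$ with inner product $\langle x|y\rangle=\psi(x^*y)$, $B\otimes B$ carries the inner product from $\psi\otimes\psi$, and $(\cdot)^\dagger$ is the Hilbert space adjoint of operators. For linear maps $S,T:B\to B$, the Schur product is $S\bullet T=\delta^{-2}m(S\otimes T)m^\dagger$ and the involution is $T^*(x)=(T(x^* ))^*$. A quantum graph is a triple $\mathcal{G}=(B,\psi,A)$ with $(B,\psi)$ a quantum set and $A:B\to B$ linear satisfying $A\bullet A=A$. It is real if $A^*=A$ and tracial if $\psi$ is a trace. Its quantum relation is $\mathcal{S}=\{A\bullet T:T\in B(L^2(B,\psi))\}$. $K_2$ denotes the quantum graph $(\mathbb{C}^2,\tau,A_{K_2})$ with $\tau(a,b)=(a+b)/2$ and $A_{K_2}=\begin{pmatrix}0&1\\1&0\end{pmatrix}$; its quantum relation $\mathcal{S}_{K_2}$ is the set of $2\times2$ matrices with zero diagonal. For a unital $*$-homomorphism $f:\mathbb{C}^2\to B$, $f^\dagger$ is the adjoint of $f:L^2(\mathbb{C}^2,\tau)\to L^2(B,\psi)$. $\mathcal{G}$ is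 bipartite if there is a surjective graph homomorphism $\mathcal{G}\to K_2$, i.e. an injective unital $*$-homomorphism $f:\mathbb{C}^2\to B$ with $A_{K_2}\bullet(f^\dagger Af)=f^\dagger Af$. $\mathcal{G}$ is $loc$-$2$ colorable if there is a $loc$-homomorphism $\mathcal{G}\to K_2$, i.e. a unital $*$-homomorphism $f:\mathbb{C}^2\to B$ (not required to be injective) with $f^\dagger\mathcal{S}f\subset\mathcal{S}_{K_2}$.
   Formalization: The one-vertex edgeless quantum graph (B one-dimensional and A = 0) is excluded: there the claim fails, since f(a,b) = a makes it loc-2 colorable, but no injective unital *-homomorphism from C^2 to C exists, so it is not bipartite. *)

theory Defs
  imports "HOL-Analysis.Analysis" "HOL-Library.Multiset" "HOL-Library.Nonpos_Ints"
begin

section \<open>Complex vector spaces\<close>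

class complex_vector = ab_group_add +
  fixes scaleC :: "complex \<Rightarrow> 'a \<Rightarrow> 'a" (infixr "*\<^sub>C" 75)
  assumes scaleC_add_right: "a *\<^sub>C (x + y) = a *\<^sub>C x + a *\<^sub>C y"
    and scaleC_add_left: "(a + b) *\<^sub>C x = a *\<^sub>C x + b *\<^sub>C x"
    and scaleC_scaleC: "a *\<^sub>C (b *\<^sub>C x) = (a * b) *\<^sub>C x"
    and scaleC_one: "1 *\<^sub>C x = x"

global_interpretation complex_vector:
  vector_space "scaleC :: complex \<Rightarrow> 'a \<Rightarrow> 'a::complex_vector"
  by unfold_locales (rule scaleC_add_right scaleC_add_left scaleC_scaleC scaleC_one)+

abbreviation clinear :: "('a::complex_vector \<Rightarrow> 'b::complex_vector) \<Rightarrow> bool"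
  where "clinear \<equiv> Vector_Spaces.linear scaleC scaleC"

instantiation complex :: complex_vector
begin

definition scaleC_complex :: "complex \<Rightarrow> complex \<Rightarrow> complex"
  where "scaleC_complex a x = a * x"

instance by standard (simp_all add: scaleC_complex_def algebra_simps)

end


section \<open>Tensor products\<close>

text \<open>The multiset \<open>{#(x\<^sub>1, y\<^sub>1), \<dots>, (x\<^sub>n, y\<^sub>n)#}\<close> stands for the formal sum of the
  \<open>x\<^sub>i \<otimes> y\<^sub>i\<close>; the algebraic tensor product is the quotient of the formal sums by the
  congruence generated by bilinearity.\<close>

inductive tensor_eq :: "('a::complex_vector \<times> 'b::complex_vector) multiset \<Rightarrow> ('a \<times> 'b) multiset \<Rightarrow> bool"
  where
    refl: "tensor_eq s s"
  | sym: "tensor_eq s t \<Longrightarrow> tensor_eq t s"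
  | trans: "tensor_eq s t \<Longrightarrow> tensor_eq t u \<Longrightarrow> tensor_eq s u"
  | plus: "tensor_eq s t \<Longrightarrow> tensor_eq (s + u) (t + u)"
  | zero: "tensor_eq {#(0, y)#} {#}"
  | add_left: "tensor_eq {#(x + x', y)#} {#(x, y), (x', y)#}"
  | add_right: "tensor_eq {#(x, y + y')#} {#(x, y), (x, y')#}"
  | scale: "tensor_eq {#(a *\<^sub>C x, y)#} {#(x, a *\<^sub>C y)#}"

quotient_type (overloaded) ('a, 'b) tensor =
  "('a::complex_vector \<times> 'b::complex_vector) multiset" / tensor_eq
  by (rule equivpI) (auto intro!: reflpI sympI transpI intro: tensor_eq.refl tensor_eq.sym tensor_eq.trans)

lemma tensor_eq_add:
  assumes "tensor_eq s t" "tensor_eq s' t'"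
  shows "tensor_eq (s + s') (t + t')"
  using tensor_eq.plus[OF assms(1), of s'] tensor_eq.plus[OF assms(2), of t]
  by (metis add.commute tensor_eq.trans)

lemma tensor_eq_scale:
  assumes "tensor_eq s t"
  shows "tensor_eq (image_mset (map_prod (scaleC a) id) s) (image_mset (map_prod (scaleC a) id) t)"
  using assms
proof induction
  case (scale b x y)
  then show ?case
    using tensor_eq.scale[of b "a *\<^sub>C x" y] by (simp add: mult.commute)
qed (auto simp: complex_vector.scale_right_distrib intro: tensor_eq.intros)

lemma tensor_eq_scale_add:
  "tensor_eq (image_mset (map_prod (scaleC (a + b)) id) s)
    (image_mset (map_prod (scaleC a) id) s + image_mset (map_prod (scaleC b) id) s)"
proof (induction s)
  case (add p s)
  obtain x y where p: "p = (x, y)" by (cases p)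
  show ?case
    using tensor_eq_add[OF tensor_eq.add_left[of "a *\<^sub>C x" "b *\<^sub>C x" y] add.IH]
    by (simp add: p complex_vector.scale_left_distrib add_mset_commute)
qed (simp add: tensor_eq.refl)

instantiation tensor :: (complex_vector, complex_vector) complex_vector
begin

lift_definition zero_tensor :: "('a, 'b) tensor" is "{#}" .

lift_definition plus_tensor :: "('a, 'b) tensor \<Rightarrow> ('a, 'b) tensor \<Rightarrow> ('a, 'b) tensor" is "(+)"
  by (rule tensor_eq_add)

lift_definition scaleC_tensor :: "complex \<Rightarrow> ('a, 'b) tensor \<Rightarrow> ('a, 'b) tensor"
  is "\<lambda>a. image_mset (map_prod (scaleC a) id)"
  by (rule tensor_eq_scale)

definition uminus_tensor :: "('a, 'b) tensor \<Rightarrow> ('a, 'b) tensor"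
  where "uminus_tensor t = (- 1) *\<^sub>C t"

definition minus_tensor :: "('a, 'b) tensor \<Rightarrow> ('a, 'b) tensor \<Rightarrow> ('a, 'b) tensor"
  where "minus_tensor s t = s + (- t)"

instance
proof
  fix r s t :: "('a, 'b) tensor" and a b :: complex
  show "r + s + t = r + (s + t)"
    by transfer (simp add: add.assoc tensor_eq.refl)
  show "s + t = t + s"
    by transfer (simp add: add.commute tensor_eq.refl)
  show "0 + t = t"
    by transfer (simp add: tensor_eq.refl)
  show "s - t = s + - t"
    by (simp add: minus_tensor_def)
  show "a *\<^sub>C (s + t) = a *\<^sub>C s + a *\<^sub>C t"
    by transfer (simp add: tensor_eq.refl)
  show add: "(a + b) *\<^sub>C t = a *\<^sub>C t + b *\<^sub>C t" for a b
    by transfer (rule tensor_eq_scale_add)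
  show "a *\<^sub>C b *\<^sub>C t = (a * b) *\<^sub>C t"
    by transfer (simp add: multiset.map_comp comp_def map_prod_def case_prod_unfold tensor_eq.refl)
  show one: "1 *\<^sub>C t = t"
    by transfer (simp add: map_prod_def tensor_eq.refl)
  have zero: "0 *\<^sub>C t = 0"
  proof transfer
    fix t :: "('a \<times> 'b) multiset"
    show "tensor_eq (image_mset (map_prod (scaleC 0) id) t) {#}"
    proof (induction t)
      case (add p t)
      obtain x y where "p = (x, y)" by (cases p)
      then show ?case
        using tensor_eq_add[OF tensor_eq.zero[of y] add.IH] by simp
    qed (simp add: tensor_eq.refl)
  qed
  show "- t + t = 0"
    using add[of "- 1" 1] by (simp add: uminus_tensor_def one zero)
qed

end

lift_definition tensor_pair :: "'a::complex_vector \<Rightarrow> 'b::complex_vector \<Rightarrow> ('a, 'b) tensor" (infixr "\<otimes>" 70)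
  is "\<lambda>x y. {#(x, y)#}" .

text \<open>The linear map induced by a bilinear map \<open>\<beta>\<close>; the value does not depend on the chosen
  representative of \<open>t\<close> provided that \<open>\<beta>\<close> is bilinear.\<close>

definition tensor_lift ::
    "('a::complex_vector \<Rightarrow> 'b::complex_vector \<Rightarrow> 'c::complex_vector) \<Rightarrow> ('a, 'b) tensor \<Rightarrow> 'c"
  where "tensor_lift \<beta> t = (\<Sum>(x, y)\<in>#rep_tensor t. \<beta> x y)"

definition cbilinear :: "('a::complex_vector \<Rightarrow> 'b::complex_vector \<Rightarrow> 'c::complex_vector) \<Rightarrow> bool"
  where "cbilinear \<beta> \<longleftrightarrow> (\<forall>y. clinear (\<lambda>x. \<beta> x y)) \<and> (\<forall>x. clinear (\<beta> x))"

lemma tensor_lift_abs: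
  assumes "cbilinear \<beta>"
  shows "tensor_lift \<beta> (abs_tensor s) = (\<Sum>(x, y)\<in>#s. \<beta> x y)"
proof -
  have lin: "clinear (\<lambda>x. \<beta> x y)" "clinear (\<beta> x)" for x y
    using assms by (auto simp: cbilinear_def)
  interpret L: Vector_Spaces.linear scaleC scaleC "\<lambda>x. \<beta> x y" for y by (rule lin)
  interpret R: Vector_Spaces.linear scaleC scaleC "\<beta> x" for x by (rule lin)
  have "(\<Sum>(x, y)\<in>#s. \<beta> x y) = (\<Sum>(x, y)\<in>#t. \<beta> x y)" if "tensor_eq s t" for s t
    using that by induction (simp_all add: L.add L.scale L.zero R.add R.scale)
  moreover have "tensor_eq (rep_tensor (abs_tensor s)) s"
    by (metis Quotient_rep_abs Quotient_tensor tensor_eq.refl)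
  ultimately show ?thesis
    by (simp add: tensor_lift_def)
qed

lemma tensor_lift_pair: "cbilinear \<beta> \<Longrightarrow> tensor_lift \<beta> (x \<otimes> y) = \<beta> x y"
  by (simp add: tensor_pair.abs_eq tensor_lift_abs)

lemma clinear_tensor_lift:
  assumes "cbilinear \<beta>"
  shows "clinear (tensor_lift \<beta>)"
proof -
  have lin: "clinear (\<lambda>x. \<beta> x y)" for y
    using assms by (auto simp: cbilinear_def)
  interpret L: Vector_Spaces.linear scaleC scaleC "\<lambda>x. \<beta> x y" for y by (rule lin)
  show ?thesis
  proof (unfold_locales, goal_cases)
    case (1 s t)
    show ?case
      by (induction s rule: tensor.abs_induct, induction t rule: tensor.abs_induct)
        (simp add: plus_tensor.abs_eq tensor_lift_abs[OF assms])
  next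
    case (2 a t)
    show ?case
    proof (induction t rule: tensor.abs_induct)
      fix s
      have "(\<Sum>(x, y)\<in>#image_mset (map_prod (scaleC a) id) s. \<beta> x y) = a *\<^sub>C (\<Sum>(x, y)\<in>#s. \<beta> x y)"
        by (induction s) (auto simp: L.scale complex_vector.scale_right_distrib)
      then show "tensor_lift \<beta> (a *\<^sub>C abs_tensor s) = a *\<^sub>C tensor_lift \<beta> (abs_tensor s)"
        by (simp add: scaleC_tensor.abs_eq tensor_lift_abs[OF assms])
    qed
  qed
qed

definition tensor_map ::
    "('a::complex_vector \<Rightarrow> 'c::complex_vector) \<Rightarrow> ('b::complex_vector \<Rightarrow> 'd::complex_vector) \<Rightarrow>
      ('a, 'b) tensor \<Rightarrow> ('c, 'd) tensor"
  where "tensor_map S T = tensor_lift (\<lambda>x y. S x \<otimes> T y)"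


section \<open>Finite-dimensional C*-algebras\<close>

text \<open>Completeness is not required separately: it is automatic in finite dimension.
  The superclass axiom \<open>norm 1 = 1\<close> follows from the C*-identity when \<open>1 \<noteq> 0\<close>, and the zero
  algebra has no state.\<close>

class fd_cstar_algebra = complex_vector + real_normed_algebra_1 +
  fixes star :: "'a \<Rightarrow> 'a"
  assumes scaleC_of_real: "complex_of_real r *\<^sub>C x = r *\<^sub>R x"
    and mult_scaleC_left: "(a *\<^sub>C x) * y = a *\<^sub>C (x * y)"
    and mult_scaleC_right: "x * (a *\<^sub>C y) = a *\<^sub>C (x * y)"
    and norm_scaleC: "norm (a *\<^sub>C x) = cmod a * norm x"
    and star_add: "star (x + y) = star x + star y"
    and star_scaleC: "star (a *\<^sub>C x) = cnj a *\<^sub>C star x"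
    and star_mult: "star (x * y) = star y * star x"
    and star_star: "star (star x) = x"
    and cstar_identity: "norm (star x * x) = (norm x)\<^sup>2"
    and finite_dimensional: "\<exists>S. finite S \<and> (\<forall>x. \<exists>c. x = (\<Sum>s\<in>S. c s *\<^sub>C s))"

definition unital_star_hom :: "('a::fd_cstar_algebra \<Rightarrow> 'b::fd_cstar_algebra) \<Rightarrow> bool"
  where "unital_star_hom f \<longleftrightarrow> clinear f \<and> f 1 = 1 \<and>
    (\<forall>x y. f (x * y) = f x * f y) \<and> (\<forall>x. f (star x) = star (f x))"

definition faithful_state :: "('a::fd_cstar_algebra \<Rightarrow> complex) \<Rightarrow> bool"
  where "faithful_state \<psi> \<longleftrightarrow> clinear \<psi> \<and> \<psi> 1 = 1 \<and>
    (\<forall>x. \<psi> (star x * x) \<in> \<real>\<^sub>\<ge>\<^sub>0) \<and> (\<forall>x. \<psi> (star x * x) = 0 \<longrightarrow> x = 0)"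

definition tracial :: "('a::fd_cstar_algebra \<Rightarrow> complex) \<Rightarrow> bool"
  where "tracial \<psi> \<longleftrightarrow> (\<forall>x y. \<psi> (x * y) = \<psi> (y * x))"


section \<open>Quantum sets\<close>

definition ip :: "('a::fd_cstar_algebra \<Rightarrow> complex) \<Rightarrow> 'a \<Rightarrow> 'a \<Rightarrow> complex"
  where "ip \<psi> x y = \<psi> (star x * y)"

text \<open>The sesquilinear extension of
  \<open>\<langle>x \<otimes> y | x' \<otimes> y'\<rangle> = \<langle>x | x'\<rangle> \<langle>y | y'\<rangle>\<close>; the inner \<open>cnj\<close> turns the antilinear dependence
  on \<open>x\<close> and \<open>y\<close> into a bilinear one, to which \<^const>\<open>tensor_lift\<close> applies.\<close>

definition tensor_ip ::
    "('a::fd_cstar_algebra \<Rightarrow> complex) \<Rightarrow> ('a, 'a) tensor \<Rightarrow> ('a, 'a) tensor \<Rightarrow> complex"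
  where "tensor_ip \<psi> s t =
    tensor_lift (\<lambda>x' y'. cnj (tensor_lift (\<lambda>x y. cnj (ip \<psi> x x' * ip \<psi> y y')) s)) t"

text \<open>The adjoint of \<open>T\<close> with respect to inner products \<open>g\<close> on the domain and \<open>h\<close> on the codomain.\<close>

definition adjoint_wrt ::
    "('a \<Rightarrow> 'a \<Rightarrow> complex) \<Rightarrow> ('b \<Rightarrow> 'b \<Rightarrow> complex) \<Rightarrow> ('a \<Rightarrow> 'b) \<Rightarrow> 'b \<Rightarrow> 'a"
  where "adjoint_wrt g h T = (THE S. \<forall>x y. h (T x) y = g x (S y))"

definition tensor_mult :: "('a::fd_cstar_algebra, 'a) tensor \<Rightarrow> 'a"
  where "tensor_mult = tensor_lift (*)"

definition comult :: "('a::fd_cstar_algebra \<Rightarrow> complex) \<Rightarrow> 'a \<Rightarrow> ('a, 'a) tensor"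
  where "comult \<psi> = adjoint_wrt (tensor_ip \<psi>) (ip \<psi>) tensor_mult"

definition delta_form :: "('a::fd_cstar_algebra \<Rightarrow> complex) \<Rightarrow> real \<Rightarrow> bool"
  where "delta_form \<psi> \<delta> \<longleftrightarrow> \<delta> \<ge> 0 \<and> (\<forall>x. tensor_mult (comult \<psi> x) = complex_of_real (\<delta>\<^sup>2) *\<^sub>C x)"

definition quantum_set :: "('a::fd_cstar_algebra \<Rightarrow> complex) \<Rightarrow> bool"
  where "quantum_set \<psi> \<longleftrightarrow> faithful_state \<psi> \<and> (\<exists>\<delta>. delta_form \<psi> \<delta>)"

text \<open>Since \<open>1 \<noteq> 0\<close>, the number \<open>\<delta>\<close> is determined by \<open>\<psi>\<close>.\<close>

definition delta :: "('a::fd_cstar_algebra \<Rightarrow> complex) \<Rightarrow> real"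
  where "delta \<psi> = (THE \<delta>. delta_form \<psi> \<delta>)"


section \<open>Quantum graphs\<close>

definition schur ::
    "('a::fd_cstar_algebra \<Rightarrow> complex) \<Rightarrow> ('a \<Rightarrow> 'a) \<Rightarrow> ('a \<Rightarrow> 'a) \<Rightarrow> 'a \<Rightarrow> 'a"
  where "schur \<psi> S T x =
    complex_of_real (inverse ((delta \<psi>)\<^sup>2)) *\<^sub>C tensor_mult (tensor_map S T (comult \<psi> x))"

definition quantum_graph :: "('a::fd_cstar_algebra \<Rightarrow> complex) \<Rightarrow> ('a \<Rightarrow> 'a) \<Rightarrow> bool"
  where "quantum_graph \<psi> A \<longleftrightarrow> quantum_set \<psi> \<and> clinear A \<and> schur \<psi> A A = A"

definition involution :: "('a::fd_cstar_algebra \<Rightarrow> 'a) \<Rightarrow> 'a \<Rightarrow> 'a"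
  where "involution T x = star (T (star x))"

definition real_graph :: "('a::fd_cstar_algebra \<Rightarrow> 'a) \<Rightarrow> bool"
  where "real_graph A \<longleftrightarrow> involution A = A"

definition quantum_relation ::
    "('a::fd_cstar_algebra \<Rightarrow> complex) \<Rightarrow> ('a \<Rightarrow> 'a) \<Rightarrow> ('a \<Rightarrow> 'a) set"
  where "quantum_relation \<psi> A = {schur \<psi> A T |T. clinear T}"

text \<open>Homomorphisms \<open>(B, \<psi>, A) \<rightarrow> (B', \<psi>', A')\<close> are given by unital *-homomorphisms
  \<open>f : B' \<rightarrow> B\<close> in the opposite direction; \<open>pullback \<psi> \<psi>' f T\<close> is the map \<open>f\<^sup>\<dagger> T f\<close> on \<open>B'\<close>.\<close>

definition pullback ::
    "('b::fd_cstar_algebra \<Rightarrow> complex) \<Rightarrow> ('c::fd_cstar_algebra \<Rightarrow> complex) \<Rightarrow>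
      ('c \<Rightarrow> 'b) \<Rightarrow> ('b \<Rightarrow> 'b) \<Rightarrow> 'c \<Rightarrow> 'c"
  where "pullback \<psi> \<psi>' f T = adjoint_wrt (ip \<psi>') (ip \<psi>) f \<circ> T \<circ> f"

definition graph_hom ::
    "('b::fd_cstar_algebra \<Rightarrow> complex) \<Rightarrow> ('b \<Rightarrow> 'b) \<Rightarrow>
      ('c::fd_cstar_algebra \<Rightarrow> complex) \<Rightarrow> ('c \<Rightarrow> 'c) \<Rightarrow> ('c \<Rightarrow> 'b) \<Rightarrow> bool"
  where "graph_hom \<psi> A \<psi>' A' f \<longleftrightarrow> unital_star_hom f \<and>
    schur \<psi>' A' (pullback \<psi> \<psi>' f A) = pullback \<psi> \<psi>' f A"

definition loc_hom ::
    "('b::fd_cstar_algebra \<Rightarrow> complex) \<Rightarrow> ('b \<Rightarrow> 'b) \<Rightarrow>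
      ('c::fd_cstar_algebra \<Rightarrow> complex) \<Rightarrow> ('c \<Rightarrow> 'c) \<Rightarrow> ('c \<Rightarrow> 'b) \<Rightarrow> bool"
  where "loc_hom \<psi> A \<psi>' A' f \<longleftrightarrow> unital_star_hom f \<and>
    pullback \<psi> \<psi>' f ` quantum_relation \<psi> A \<subseteq> quantum_relation \<psi>' A'"


section \<open>The graph \<open>K\<^sub>2\<close>\<close>

text \<open>The C*-algebra \<open>\<complex>\<^sup>2\<close> with the supremum norm (the library's norm on \<open>complex ^ 2\<close> and on
  \<open>complex \<times> complex\<close> is the Euclidean one).\<close>

datatype C2 = C2 (C2_fst: complex) (C2_snd: complex)

lemma C2_eq_iff: "x = y \<longleftrightarrow> C2_fst x = C2_fst y \<and> C2_snd x = C2_snd y"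
  by (auto intro: C2.expand)

instantiation C2 :: complex_vector
begin

definition zero_C2 :: C2 where "0 = C2 0 0"
definition plus_C2 :: "C2 \<Rightarrow> C2 \<Rightarrow> C2" where "x + y = C2 (C2_fst x + C2_fst y) (C2_snd x + C2_snd y)"
definition minus_C2 :: "C2 \<Rightarrow> C2 \<Rightarrow> C2" where "x - y = C2 (C2_fst x - C2_fst y) (C2_snd x - C2_snd y)"
definition uminus_C2 :: "C2 \<Rightarrow> C2" where "- x = C2 (- C2_fst x) (- C2_snd x)"
definition scaleC_C2 :: "complex \<Rightarrow> C2 \<Rightarrow> C2" where "a *\<^sub>C x = C2 (a * C2_fst x) (a * C2_snd x)"

instance
  by standard (auto simp: C2_eq_iff zero_C2_def plus_C2_def minus_C2_def uminus_C2_def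
      scaleC_C2_def algebra_simps)

end

instantiation C2 :: fd_cstar_algebra
begin

definition one_C2 :: C2 where "1 = C2 1 1"
definition times_C2 :: "C2 \<Rightarrow> C2 \<Rightarrow> C2" where "x * y = C2 (C2_fst x * C2_fst y) (C2_snd x * C2_snd y)"
definition scaleR_C2 :: "real \<Rightarrow> C2 \<Rightarrow> C2" where "r *\<^sub>R x = complex_of_real r *\<^sub>C (x :: C2)"
definition star_C2 :: "C2 \<Rightarrow> C2" where "star x = C2 (cnj (C2_fst x)) (cnj (C2_snd x))"
definition norm_C2 :: "C2 \<Rightarrow> real" where "norm x = max (cmod (C2_fst x)) (cmod (C2_snd x))"
definition dist_C2 :: "C2 \<Rightarrow> C2 \<Rightarrow> real" where "dist x y = norm (x - y :: C2)"
definition sgn_C2 :: "C2 \<Rightarrow> C2" where "sgn x = inverse (norm x) *\<^sub>R (x :: C2)"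
definition uniformity_C2 :: "(C2 \<times> C2) filter"
  where "uniformity = (INF e\<in>{0<..}. principal {(x :: C2, y). dist x y < e})"
definition open_C2 :: "C2 set \<Rightarrow> bool"
  where "open U \<longleftrightarrow> (\<forall>x\<in>U. eventually (\<lambda>(x', y :: C2). x' = x \<longrightarrow> y \<in> U) uniformity)"

lemmas C2_simps = C2_eq_iff zero_C2_def one_C2_def plus_C2_def minus_C2_def uminus_C2_def
  times_C2_def scaleC_C2_def scaleR_C2_def star_C2_def

instance
proof
  fix x y :: C2 and r :: real and a :: complex
  show "norm (x + y) \<le> norm x + norm y"
    using norm_triangle_ineq[of "C2_fst x" "C2_fst y"] norm_triangle_ineq[of "C2_snd x" "C2_snd y"]
    by (simp add: norm_C2_def C2_simps) linarith
  show "norm (a *\<^sub>C x) = cmod a * norm x"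
    by (simp add: norm_C2_def C2_simps norm_mult max_mult_distrib_left)
  then show "norm (r *\<^sub>R x) = \<bar>r\<bar> * norm x"
    by (simp add: norm_C2_def C2_simps norm_mult max_mult_distrib_left)
  show "norm (x * y) \<le> norm x * norm y"
    by (auto simp: norm_C2_def C2_simps norm_mult le_max_iff_disj intro!: mult_mono)
  show "norm (star x * x) = (norm x)\<^sup>2"
    using power_mono[of "cmod (C2_fst x)" "cmod (C2_snd x)" 2] power_mono[of "cmod (C2_snd x)" "cmod (C2_fst x)" 2]
    by (auto simp: norm_C2_def C2_simps norm_mult max_def simp flip: power2_eq_square)
  show "\<exists>S. finite S \<and> (\<forall>x :: C2. \<exists>c. x = (\<Sum>s\<in>S. c s *\<^sub>C s))"
  proof (intro exI[of _ "{C2 1 0, C2 0 1}"] conjI allI)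
    fix z :: C2
    show "\<exists>c. z = (\<Sum>s\<in>{C2 1 0, C2 0 1}. c s *\<^sub>C s)"
      by (rule exI[of _ "\<lambda>s. if s = C2 1 0 then C2_fst z else C2_snd z"]) (simp add: C2_simps)
  qed simp
qed (auto simp: C2_simps norm_C2_def dist_C2_def sgn_C2_def uniformity_C2_def open_C2_def
    max_def algebra_simps split: if_splits)

end

definition tau :: "C2 \<Rightarrow> complex"
  where "tau x = (C2_fst x + C2_snd x) / 2"

definition A_K2 :: "C2 \<Rightarrow> C2"
  where "A_K2 x = C2 (C2_snd x) (C2_fst x)"

text \<open>A surjective homomorphism to \<open>K\<^sub>2\<close> is one whose underlying *-homomorphism is injective.\<close>

definition bipartite :: "('b::fd_cstar_algebra \<Rightarrow> complex) \<Rightarrow> ('b \<Rightarrow> 'b) \<Rightarrow> bool"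
  where "bipartite \<psi> A \<longleftrightarrow> (\<exists>f. graph_hom \<psi> A tau A_K2 f \<and> inj f)"

definition loc_2_colorable :: "('b::fd_cstar_algebra \<Rightarrow> complex) \<Rightarrow> ('b \<Rightarrow> 'b) \<Rightarrow> bool"
  where "loc_2_colorable \<psi> A \<longleftrightarrow> (\<exists>f. loc_hom \<psi> A tau A_K2 f)"

end

theory Submission
  imports Defs "HOL-Computational_Algebra.Fundamental_Theorem_Algebra"
begin

text \<open>A unital *-homomorphism \<open>f\<close> out of \<open>\<complex>\<^sup>2\<close> is the same as a projection \<open>p\<close>, the image of
  \<open>(1, 0)\<close>, with complement \<open>q = 1 - p\<close>. The entries of the \<open>2 \<times> 2\<close> matrix \<open>f\<^sup>\<dagger> T f\<close> are
  \<open>2 \<psi>(p\<^sub>i T(p\<^sub>j))\<close>, and Schur multiplication by the adjacency matrix of \<open>K\<^sub>2\<close> erases the diagonal.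
  Hence \<open>f\<close> is a graph homomorphism iff \<open>\<psi>(p A(p)) = 0 = \<psi>(q A(q))\<close>, and a \<open>loc\<close>-homomorphism
  iff the same holds with \<open>A \<bullet> T\<close> in place of \<open>A\<close> for every \<open>T\<close>.

  Taking \<open>T = A\<close>, the second condition implies the first. For the converse, let \<open>(e)\<close> run through
  an orthonormal basis of \<open>L\<^sup>2(B, \<psi>)\<close>. Since \<open>\<psi>\<close> is a trace, the comultiplication is
  \<open>m\<^sup>\<dagger>(x y) = \<Sum> x e\<^sup>* \<otimes> e y\<close> (lemma \<open>comult_mult\<close>); this gives
  \<open>A(p) = (A \<bullet> A)(p p) = \<delta>\<^sup>-\<^sup>2 \<Sum> A(p e\<^sup>*) A(e p)\<close>, and \<open>A(e p) = A(p e\<^sup>*)\<^sup>*\<close> because \<open>A\<close> is real.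
  So \<open>\<delta>\<^sup>2 \<psi>(p A(p))\<close> is the sum of the squared norms of the \<open>(p A(p e\<^sup>*))\<^sup>*\<close>, and when it
  vanishes, \<open>p A(p b) = 0\<close> for all \<open>b\<close> (lemma \<open>corner_vanishes\<close>). This kills
  \<open>p (A \<bullet> T)(p) = \<delta>\<^sup>-\<^sup>2 \<Sum> p A(p e\<^sup>*) T(e)\<close> for every \<open>T\<close>. Graph homomorphisms and
  \<open>loc\<close>-homomorphisms to \<open>K\<^sub>2\<close> are therefore the same maps.

  What remains is injectivity. If \<open>f\<close> is not injective, then \<open>p\<close> or \<open>q\<close> is \<open>1\<close>, and
  \<open>1 A(1 b) = 0\<close> forces \<open>A = 0\<close>. For the zero map any projection other than \<open>0\<close> and \<open>1\<close>
  provides an injective homomorphism, and such a projection exists unless \<open>B = \<complex>\<close>, the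
  excluded graph with one vertex and no edge: if \<open>x\<close> is not
  a scalar, then for an eigenvalue \<open>a\<close> of left multiplication by \<open>x\<close> the kernel of
  \<open>k \<mapsto> (x - a) k\<close> is a proper nonzero right ideal, and every right ideal is generated by
  a projection (lemma \<open>right_ideal_is_principal\<close>).\<close>

section \<open>Tensor products of linear maps\<close>

lemma clinearI:
  assumes "\<And>x y. F (x + y) = F x + F y" "\<And>a x. F (a *\<^sub>C x) = a *\<^sub>C F x"
  shows "clinear F"
  using assms by unfold_locales

lemma clinear_add: "clinear F \<Longrightarrow> F (x + y) = F x + F y"
  and clinear_scale: "clinear F \<Longrightarrow> F (a *\<^sub>C x) = a *\<^sub>C F x"
  and clinear_zero: "clinear F \<Longrightarrow> F 0 = 0"
  and clinear_diff: "clinear F \<Longrightarrow> F (x - y) = F x - F y"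
  and clinear_sum: "clinear F \<Longrightarrow> F (\<Sum>i\<in>I. g i) = (\<Sum>i\<in>I. F (g i))"
proof -
  assume "clinear F"
  then interpret F: Vector_Spaces.linear scaleC scaleC F .
  show "F (x + y) = F x + F y" "F (a *\<^sub>C x) = a *\<^sub>C F x" "F 0 = 0"
    "F (x - y) = F x - F y" "F (\<Sum>i\<in>I. g i) = (\<Sum>i\<in>I. F (g i))"
    by (rule F.add F.scale F.zero F.diff F.sum)+
qed

lemma cbilinearI:
  assumes "\<And>x x' y. \<beta> (x + x') y = \<beta> x y + \<beta> x' y" "\<And>a x y. \<beta> (a *\<^sub>C x) y = a *\<^sub>C \<beta> x y"
    "\<And>x y y'. \<beta> x (y + y') = \<beta> x y + \<beta> x y'" "\<And>a x y. \<beta> x (a *\<^sub>C y) = a *\<^sub>C \<beta> x y"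
  shows "cbilinear \<beta>"
  unfolding cbilinear_def using assms by (auto intro!: clinearI)

lemma cbilinear_tensor_pair: "cbilinear ((\<otimes>) :: 'a::complex_vector \<Rightarrow> 'b::complex_vector \<Rightarrow> _)"
proof (rule cbilinearI)
  fix x x' :: 'a and y y' :: 'b and a
  show "(x + x') \<otimes> y = x \<otimes> y + x' \<otimes> y"
    unfolding tensor_pair.abs_eq plus_tensor.abs_eq tensor.abs_eq_iff
    using tensor_eq.add_left[of x x' y] by (simp add: add_mset_commute)
  show "x \<otimes> (y + y') = x \<otimes> y + x \<otimes> y'"
    unfolding tensor_pair.abs_eq plus_tensor.abs_eq tensor.abs_eq_iff
    using tensor_eq.add_right[of x y y'] by (simp add: add_mset_commute)
  show "(a *\<^sub>C x) \<otimes> y = a *\<^sub>C (x \<otimes> y)"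
    by transfer (simp add: tensor_eq.refl)
  show "x \<otimes> (a *\<^sub>C y) = a *\<^sub>C (x \<otimes> y)"
    by transfer (simp add: tensor_eq.sym[OF tensor_eq.scale])
qed

lemma cbilinear_left: "cbilinear \<beta> \<Longrightarrow> clinear (\<lambda>x. \<beta> x y)"
  and cbilinear_right: "cbilinear \<beta> \<Longrightarrow> clinear (\<beta> x)"
  by (simp_all add: cbilinear_def)

text \<open>Every tensor is a finite sum of pure tensors, so a linear map is determined by its values on
  these.\<close>

lemma clinear_tensor_eqI:
  assumes "clinear F" "clinear G" "\<And>x y. F (x \<otimes> y) = G (x \<otimes> y)"
  shows "F t = G t"
proof (induction t rule: tensor.abs_induct)
  fix s :: "('a \<times> 'b) multiset"
  show "F (abs_tensor s) = G (abs_tensor s)"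
  proof (induction s)
    case empty
    then show ?case
      using clinear_zero[OF assms(1)] clinear_zero[OF assms(2)] by (simp add: zero_tensor.abs_eq)
  next
    case (add z s)
    obtain x y where "z = (x, y)" by (cases z)
    then have "abs_tensor (add_mset z s) = x \<otimes> y + abs_tensor s"
      by (simp add: tensor_pair.abs_eq plus_tensor.abs_eq)
    then show ?case
      using add by (simp add: clinear_add[OF assms(1)] clinear_add[OF assms(2)] assms(3))
  qed
qed

lemma cbilinear_compose:
  assumes "cbilinear \<beta>" "clinear S" "clinear T"
  shows "cbilinear (\<lambda>x y. \<beta> (S x) (T y))"
  by (rule cbilinearI)
    (simp_all only: clinear_add[OF assms(2)] clinear_scale[OF assms(2)] clinear_add[OF assms(3)]
      clinear_scale[OF assms(3)] clinear_add[OF cbilinear_left[OF assms(1)]]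
      clinear_scale[OF cbilinear_left[OF assms(1)]] clinear_add[OF cbilinear_right[OF assms(1)]]
      clinear_scale[OF cbilinear_right[OF assms(1)]])

lemma clinear_tensor_map: "clinear S \<Longrightarrow> clinear T \<Longrightarrow> clinear (tensor_map S T)"
  unfolding tensor_map_def
  by (intro clinear_tensor_lift cbilinear_compose[OF cbilinear_tensor_pair])

lemma tensor_map_pair: "clinear S \<Longrightarrow> clinear T \<Longrightarrow> tensor_map S T (x \<otimes> y) = S x \<otimes> T y"
  unfolding tensor_map_def
  by (subst tensor_lift_pair) (auto intro: cbilinear_compose[OF cbilinear_tensor_pair])

lemma cbilinear_mult: "cbilinear ((*) :: 'a::fd_cstar_algebra \<Rightarrow> _)"
  by (rule cbilinearI) (simp_all add: algebra_simps mult_scaleC_left mult_scaleC_right)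

lemma clinear_tensor_mult: "clinear tensor_mult"
  unfolding tensor_mult_def by (intro clinear_tensor_lift cbilinear_mult)

lemma tensor_mult_pair: "tensor_mult (x \<otimes> y) = x * y"
  unfolding tensor_mult_def by (rule tensor_lift_pair[OF cbilinear_mult])


section \<open>The star and eigenvectors of left multiplication\<close>

lemma star_zero [simp]: "star (0 :: 'a::fd_cstar_algebra) = 0"
  using star_add[of 0 "0 :: 'a"] by simp

lemma star_one [simp]: "star (1 :: 'a::fd_cstar_algebra) = 1"
  by (metis mult.left_neutral mult.right_neutral star_mult star_star)

lemma star_minus: "star (- x) = - star (x :: 'a::fd_cstar_algebra)"
  using star_add[of x "- x"] by (simp add: eq_neg_iff_add_eq_0 add.commute)

lemma star_diff: "star (x - y) = star x - star (y :: 'a::fd_cstar_algebra)"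
  using star_add[of x "- y"] by (simp add: star_minus)

lemma star_sum: "star (\<Sum>i\<in>I. g i) = (\<Sum>i\<in>I. star (g i :: 'a::fd_cstar_algebra))"
  by (induction I rule: infinite_finite_induct) (simp_all add: star_add)

definition poly_at :: "'a::fd_cstar_algebra \<Rightarrow> complex poly \<Rightarrow> 'a"
  where "poly_at x q = (\<Sum>i\<le>degree q. coeff q i *\<^sub>C x ^ i)"

lemma poly_at_bound: "degree q \<le> n \<Longrightarrow> poly_at x q = (\<Sum>i\<le>n. coeff q i *\<^sub>C x ^ i)"
  unfolding poly_at_def
  by (rule sum.mono_neutral_left) (auto simp: coeff_eq_0)

lemma poly_at_linear_factor:
  "poly_at x ([:- a, 1:] * r) = x * poly_at x r - a *\<^sub>C poly_at x r"
proof -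
  have "poly_at x ([:- a, 1:] * r) = (\<Sum>i\<le>Suc (degree r). coeff ([:- a, 1:] * r) i *\<^sub>C x ^ i)"
    by (rule poly_at_bound, rule order_trans[OF degree_mult_le]) simp
  also have "\<dots> = (\<Sum>i\<le>Suc (degree r). coeff (pCons 0 r) i *\<^sub>C x ^ i)
      - (\<Sum>i\<le>Suc (degree r). a *\<^sub>C coeff r i *\<^sub>C x ^ i)"
    by (simp add: complex_vector.scale_left_diff_distrib sum_subtractf complex_vector.scale_minus_left algebra_simps)
  also have "(\<Sum>i\<le>Suc (degree r). coeff (pCons 0 r) i *\<^sub>C x ^ i) = x * poly_at x r"
    unfolding sum.atMost_Suc_shift
    by (simp add: poly_at_def sum_distrib_left mult_scaleC_right)
  also have "(\<Sum>i\<le>Suc (degree r). a *\<^sub>C coeff r i *\<^sub>C x ^ i) = a *\<^sub>C poly_at x r"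
    by (simp only: poly_at_bound[of r "Suc (degree r)"] complex_vector.scale_sum_right)
  finally show ?thesis .
qed

lemma finite_spanning_set_exists:
  obtains S :: "'a::fd_cstar_algebra set" where "finite S" "complex_vector.span S = UNIV"
proof -
  obtain S :: "'a set" where S: "finite S" "\<forall>x. \<exists>c. x = (\<Sum>s\<in>S. c s *\<^sub>C s)"
    using finite_dimensional by blast
  have "x \<in> complex_vector.span S" for x
  proof -
    obtain c where "x = (\<Sum>s\<in>S. c s *\<^sub>C s)"
      using S(2) by blast
    then show ?thesis
      by (simp add: complex_vector.span_base complex_vector.span_scale complex_vector.span_sum)
  qed
  then show ?thesis
    using that S(1) by blast
qed

text \<open>The powers \<open>x\<^sup>0, \<dots>, x\<^sup>n\<close> are one more than the dimension allows to be independent. The case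
  that two of them coincide needs a separate argument because linear dependence is a property of
  the set of powers and does not see repetitions.\<close>

lemma annihilating_poly_exists: "\<exists>q. q \<noteq> 0 \<and> poly_at (x :: 'a::fd_cstar_algebra) q = 0"
proof -
  obtain S :: "'a set" where S: "finite S" "complex_vector.span S = UNIV"
    using finite_spanning_set_exists by blast
  define n where "n = card S"
  show ?thesis
  proof (cases "inj_on (\<lambda>i. x ^ i) {..n}")
    case True
    have "complex_vector.dependent ((\<lambda>i. x ^ i) ` {..n})"
    proof (rule ccontr)
      assume "\<not> ?thesis"
      then have "card ((\<lambda>i. x ^ i) ` {..n}) \<le> n"
        using complex_vector.independent_span_bound[OF S(1)] unfolding n_def S(2) by blast
      then show False
        using card_image[OF True] by simp
    qed
    then obtain u j where u: "j \<le> n" "u (x ^ j) \<noteq> 0" "(\<Sum>v\<in>(\<lambda>i. x ^ i) ` {..n}. u v *\<^sub>C v) = 0"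
      by (subst (asm) complex_vector.dependent_finite) auto
    define q where "q = (\<Sum>i\<le>n. monom (u (x ^ i)) i)"
    have c: "coeff q i = (if i \<le> n then u (x ^ i) else 0)" for i
      by (simp add: q_def coeff_sum)
    have "degree q \<le> n"
      by (rule degree_le) (simp add: c)
    then have "poly_at x q = (\<Sum>i\<le>n. u (x ^ i) *\<^sub>C x ^ i)"
      by (simp add: poly_at_bound c)
    also have "\<dots> = 0"
      using u(3) by (simp add: sum.reindex[OF True])
    finally show ?thesis
      using u c[of j] by (intro exI[of _ q]) auto
  next
    case False
    then obtain i j where ij: "x ^ i = x ^ j" "i < j"
      unfolding inj_on_def by (metis linorder_neqE_nat)
    have "degree (monom 1 j - monom 1 i :: complex poly) \<le> j"
      using ij(2) by (intro degree_diff_le) (auto simp: degree_monom_eq)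
    then have "poly_at x (monom 1 j - monom 1 i) = (\<Sum>k\<le>j. (if k = j then x ^ k else 0) - (if k = i then x ^ k else 0))"
      by (subst poly_at_bound) (auto intro!: sum.cong simp: coeff_monom scaleC_one)
    also have "\<dots> = 0"
      using ij by (simp add: sum_subtractf)
    finally have "poly_at x (monom 1 j - monom 1 i) = 0" .
    moreover have "coeff (monom 1 j - monom 1 i :: complex poly) j \<noteq> 0"
      using ij(2) by simp
    then have "(monom 1 j - monom 1 i :: complex poly) \<noteq> 0"
      by (metis coeff_0)
    ultimately show ?thesis
      by blast
  qed
qed

text \<open>Let \<open>q\<close> be an annihilating polynomial of minimal degree and \<open>a\<close> a root of it. Then
  \<open>q = (X - a) r\<close>, and \<open>r(x)\<close> is an eigenvector for \<open>a\<close>, nonzero by minimality.\<close>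

lemma left_eigenvector_exists: "\<exists>a y. y \<noteq> 0 \<and> x * y = a *\<^sub>C (y :: 'a::fd_cstar_algebra)"
proof -
  define P where "P q \<longleftrightarrow> q \<noteq> 0 \<and> poly_at x q = 0" for q
  obtain q where q: "P q" and min: "\<And>r. P r \<Longrightarrow> degree q \<le> degree r"
    using annihilating_poly_exists[of x] ex_has_least_nat[of P _ degree] unfolding P_def by blast
  have "degree q \<noteq> 0"
  proof
    assume "degree q = 0"
    then obtain c where "q = [:c:]"
      by (rule degree_eq_zeroE)
    then show False
      using q by (auto simp: P_def poly_at_def)
  qed
  then obtain a where "poly q a = 0"
    using fundamental_theorem_of_algebra[of q] by (auto simp: constant_degree)
  then obtain r where r: "q = [:- a, 1:] * r"
    by (auto simp: poly_eq_0_iff_dvd)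
  have "r \<noteq> 0"
    using r q by (auto simp: P_def)
  moreover have "degree r < degree q"
    using \<open>r \<noteq> 0\<close> unfolding r by (subst degree_mult_eq) auto
  ultimately have "poly_at x r \<noteq> 0"
    using min[of r] by (auto simp: P_def)
  then show ?thesis
    using q unfolding P_def r poly_at_linear_factor by auto
qed


section \<open>The Hilbert space of a faithful trace\<close>

text \<open>The locale serves both \<open>(B, \<psi>)\<close> and \<open>(\<complex>\<^sup>2, \<tau>)\<close>. For the latter the description of \<open>m\<^sup>\<dagger>\<close> in a
  basis comes first and is used to verify the \<open>\<delta>\<close>-form condition.\<close>

locale faithful_trace =
  fixes \<psi> :: "'b::fd_cstar_algebra \<Rightarrow> complex"
  assumes state: "faithful_state \<psi>" and trace: "tracial \<psi>"
begin

lemma clinear_psi: "clinear \<psi>"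
  using state by (simp add: faithful_state_def)

lemma psi_one: "\<psi> 1 = 1"
  using state by (simp add: faithful_state_def)

lemma psi_scale: "\<psi> (a *\<^sub>C x) = a * \<psi> x"
  using clinear_scale[OF clinear_psi] by (simp add: scaleC_complex_def)

lemmas psi_simps = clinear_add[OF clinear_psi] clinear_zero[OF clinear_psi]
  clinear_diff[OF clinear_psi] clinear_sum[OF clinear_psi] psi_scale psi_one

lemma psi_comm: "\<psi> (x * y) = \<psi> (y * x)"
  using trace by (simp add: tracial_def)

lemma psi_pos: "\<psi> (star x * x) \<in> \<real>\<^sub>\<ge>\<^sub>0"
  using state by (simp add: faithful_state_def)

lemma psi_faithful: "\<psi> (star x * x) = 0 \<Longrightarrow> x = 0"
  using state by (simp add: faithful_state_def)

text \<open>Positivity at \<open>x + 1\<close> compares the imaginary parts of \<open>\<psi>(x)\<close> and \<open>\<psi>(x\<^sup>*)\<close>, positivity at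
  \<open>x + \<i>\<close> the real parts.\<close>

lemma psi_star: "\<psi> (star x) = cnj (\<psi> x)"
proof -
  have Im0: "Im (\<psi> (star y * y)) = 0" for y
    using psi_pos[of y] by (auto simp: complex_nonneg_Reals_iff)
  have "\<psi> (star (x + 1) * (x + 1)) = \<psi> (star x * x) + \<psi> (star x) + \<psi> x + 1"
    by (simp add: star_add algebra_simps psi_simps)
  then have 1: "Im (\<psi> (star x)) + Im (\<psi> x) = 0"
    using Im0[of "x + 1"] Im0[of x] by simp
  have "\<psi> (star (x + \<i> *\<^sub>C 1) * (x + \<i> *\<^sub>C 1)) = \<psi> (star x * x) + \<i> * \<psi> (star x) - \<i> * \<psi> x + 1"
    by (simp add: star_add star_scaleC algebra_simps mult_scaleC_left mult_scaleC_right psi_simps)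
  then have 2: "Re (\<psi> (star x)) - Re (\<psi> x) = 0"
    using Im0[of "x + \<i> *\<^sub>C 1"] Im0[of x] by simp
  show ?thesis
    using 1 2 by (simp add: complex_eq_iff)
qed

lemma ip_add_right: "ip \<psi> x (y + z) = ip \<psi> x y + ip \<psi> x z"
  and ip_diff_right: "ip \<psi> x (y - z) = ip \<psi> x y - ip \<psi> x z"
  and ip_scale_right: "ip \<psi> x (a *\<^sub>C y) = a * ip \<psi> x y"
  and ip_sum_right: "ip \<psi> x (\<Sum>i\<in>I. g i) = (\<Sum>i\<in>I. ip \<psi> x (g i))"
  and ip_scale_left: "ip \<psi> (a *\<^sub>C x) y = cnj a * ip \<psi> x y"
  and ip_cnj: "cnj (ip \<psi> x y) = ip \<psi> y x"
  by (simp_all add: ip_def distrib_left right_diff_distrib left_diff_distrib mult_scaleC_right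
      mult_scaleC_left sum_distrib_left star_scaleC star_diff star_mult star_star psi_simps flip: psi_star)

lemma clinear_ip: "clinear (ip \<psi> x)"
  by (rule clinearI) (simp_all add: ip_add_right ip_scale_right scaleC_complex_def)

lemma ip_nondegenerate: "(\<And>x. ip \<psi> x y = ip \<psi> x z) \<Longrightarrow> y = z"
  using psi_faithful[of "y - z"] ip_diff_right[of "y - z" y z] by (simp add: ip_def)

definition orthonormal :: "'b set \<Rightarrow> bool"
  where "orthonormal E \<longleftrightarrow> finite E \<and> (\<forall>x\<in>E. \<forall>y\<in>E. ip \<psi> x y = (if x = y then 1 else 0))"

definition proj_on :: "'b set \<Rightarrow> 'b \<Rightarrow> 'b"
  where "proj_on E x = (\<Sum>e\<in>E. ip \<psi> e x *\<^sub>C e)"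

lemma proj_on_in_span: "proj_on E x \<in> complex_vector.span E"
  unfolding proj_on_def
  by (intro complex_vector.span_sum complex_vector.span_scale complex_vector.span_base)

lemma ip_proj_on:
  assumes "orthonormal E" "e \<in> E"
  shows "ip \<psi> e (proj_on E x) = ip \<psi> e x"
proof -
  have "ip \<psi> e (proj_on E x) = (\<Sum>e'\<in>E. if e' = e then ip \<psi> e' x else 0)"
    unfolding proj_on_def ip_sum_right ip_scale_right
    using assms by (intro sum.cong) (auto simp: orthonormal_def)
  then show ?thesis
    using assms by (simp add: orthonormal_def)
qed

lemma orthogonal_to_span:
  assumes "\<And>e. e \<in> E \<Longrightarrow> ip \<psi> r e = 0" "y \<in> complex_vector.span E"
  shows "ip \<psi> r y = 0"
  using assms(2)
proof (induction rule: complex_vector.span_induct_alt)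
  case base
  then show ?case using clinear_zero[OF clinear_ip] .
qed (simp add: ip_add_right ip_scale_right assms(1))

lemma proj_residual_orthogonal:
  assumes "orthonormal E" "y \<in> complex_vector.span E"
  shows "ip \<psi> (x - proj_on E x) y = 0"
proof (rule orthogonal_to_span[OF _ assms(2)])
  fix e assume "e \<in> E"
  then have "ip \<psi> e (x - proj_on E x) = 0"
    by (simp add: ip_diff_right ip_proj_on[OF assms(1)])
  then show "ip \<psi> (x - proj_on E x) e = 0"
    by (metis ip_cnj complex_cnj_zero)
qed

lemma proj_on_span:
  assumes "orthonormal E" "x \<in> complex_vector.span E"
  shows "proj_on E x = x"
proof -
  have "x - proj_on E x \<in> complex_vector.span E"
    using assms(2) proj_on_in_span by (rule complex_vector.span_diff)
  from proj_residual_orthogonal[OF assms(1) this] have "x - proj_on E x = 0"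
    by (intro psi_faithful) (simp add: ip_def)
  then show ?thesis by simp
qed

lemma gram_schmidt:
  assumes "finite S"
  shows "\<exists>E. orthonormal E \<and> complex_vector.span E = complex_vector.span S"
  using assms
proof induction
  case empty
  show ?case
    by (intro exI[of _ "{}"]) (simp add: orthonormal_def)
next
  case (insert a S)
  then obtain E where E: "orthonormal E" "complex_vector.span E = complex_vector.span S"
    by auto
  define r where "r = a - proj_on E a"
  have a_span: "complex_vector.span (insert a S) = complex_vector.span (insert r E)"
    unfolding complex_vector.span_insert E(2)[symmetric] r_def
  proof (rule Collect_cong)
    fix x
    show "(\<exists>k. x - k *\<^sub>C a \<in> complex_vector.span E)
      \<longleftrightarrow> (\<exists>k. x - k *\<^sub>C (a - proj_on E a) \<in> complex_vector.span E)"
    proof (rule arg_cong[of _ _ Ex], rule ext)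
      fix k
      have *: "x - k *\<^sub>C (a - proj_on E a) = (x - k *\<^sub>C a) + k *\<^sub>C proj_on E a"
        by (simp add: complex_vector.scale_right_diff_distrib)
      show "(x - k *\<^sub>C a \<in> complex_vector.span E) = (x - k *\<^sub>C (a - proj_on E a) \<in> complex_vector.span E)"
        using complex_vector.span_add_eq2[OF complex_vector.span_scale[OF proj_on_in_span]]
        unfolding * by simp
    qed
  qed
  show ?case
  proof (cases "r = 0")
    case True
    then show ?thesis
      using E a_span by auto
  next
    case False
    define s where "s = Re (ip \<psi> r r)"
    have s: "ip \<psi> r r = complex_of_real s" "s \<ge> 0"
      using psi_pos[of r] by (auto simp: s_def ip_def complex_nonneg_Reals_iff complex_eq_iff)
    have "s \<noteq> 0"
      using False psi_faithful[of r] s by (auto simp: ip_def)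
    define c where "c = complex_of_real (1 / sqrt s)"
    have c: "c \<noteq> 0" "cnj c = c" "c * c * ip \<psi> r r = 1"
      using s \<open>s \<noteq> 0\<close> by (auto simp: c_def simp flip: of_real_mult)
    have orth: "ip \<psi> r e = 0" "ip \<psi> e r = 0" if "e \<in> E" for e
      using proj_residual_orthogonal[OF E(1), of e a] that ip_cnj[of r e]
      by (auto simp: r_def complex_vector.span_base)
    have unit: "ip \<psi> (c *\<^sub>C r) (c *\<^sub>C r) = 1"
      using c by (simp add: ip_scale_left ip_scale_right mult.assoc)
    have "c *\<^sub>C r \<notin> E"
      using unit orth(1) by (auto simp: ip_scale_left)
    then have "orthonormal (insert (c *\<^sub>C r) E)"
      using E(1) orth unit unfolding orthonormal_def
      by (auto simp: ip_scale_left ip_scale_right)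
    moreover have "complex_vector.span (insert (c *\<^sub>C r) E) = complex_vector.span (insert r E)"
    proof (rule complex_vector.span_eq[THEN iffD2], intro conjI insert_subsetI)
      show "c *\<^sub>C r \<in> complex_vector.span (insert r E)"
        by (simp add: complex_vector.span_base complex_vector.span_scale)
      have "inverse c *\<^sub>C c *\<^sub>C r \<in> complex_vector.span (insert (c *\<^sub>C r) E)"
        by (intro complex_vector.span_scale complex_vector.span_base) simp
      then show "r \<in> complex_vector.span (insert (c *\<^sub>C r) E)"
        using c(1) by simp
    qed (auto intro: complex_vector.span_base)
    ultimately show ?thesis
      using a_span by auto
  qed
qed

lemma orthonormal_basis_of_subspace:
  assumes "complex_vector.subspace (K :: 'b set)"
  obtains E where "orthonormal E" "complex_vector.span E = K"
proof -
  obtain S :: "'b set" where S: "finite S" "complex_vector.span S = UNIV"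
    using finite_spanning_set_exists by blast
  obtain C where C: "C \<subseteq> K" "\<not> complex_vector.dependent C" "K \<subseteq> complex_vector.span C"
    using complex_vector.maximal_independent_subset[of K] by blast
  have "finite C"
    using complex_vector.independent_span_bound[OF S(1) C(2)] unfolding S(2) by simp
  moreover have "complex_vector.span C = K"
    using C complex_vector.span_minimal[OF C(1) assms] by auto
  ultimately show ?thesis
    using gram_schmidt[of C] that by auto
qed

text \<open>The generator is the orthogonal projection \<open>p\<close> of \<open>1\<close> onto the ideal \<open>K\<close>. For \<open>k \<in> K\<close> put
  \<open>z = (1 - p)\<^sup>* k\<close>; as \<open>1 - p\<close> is orthogonal to \<open>k z\<^sup>* \<in> K\<close>, we get \<open>\<psi>(z z\<^sup>*) = 0\<close>, so \<open>k = p\<^sup>* k\<close>.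
  For \<open>k = p\<close> this says \<open>p = p\<^sup>* p\<close>, which makes \<open>p\<close> self-adjoint.\<close>

lemma right_ideal_is_principal:
  assumes "complex_vector.subspace (K :: 'b set)" and ideal: "\<And>k b. k \<in> K \<Longrightarrow> k * b \<in> K"
  obtains p where "p \<in> K" "star p = p" "\<And>k. k \<in> K \<Longrightarrow> p * k = k"
proof -
  obtain E where E: "orthonormal E" "complex_vector.span E = K"
    using orthonormal_basis_of_subspace[OF assms(1)] .
  define p where "p = proj_on E 1"
  have pK: "p \<in> K"
    using proj_on_in_span E by (auto simp: p_def)
  have zero: "star (1 - p) * k = 0" if "k \<in> K" for k
  proof -
    define z where "z = star (1 - p) * k"
    have "ip \<psi> (1 - p) (k * star z) = 0"
      unfolding p_def using E ideal[OF that] by (intro proj_residual_orthogonal) auto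
    then have "\<psi> (z * star z) = 0"
      by (simp add: ip_def z_def mult.assoc)
    then show ?thesis
      using psi_faithful[of z] by (simp add: psi_comm z_def)
  qed
  have "p = star p * p"
    using zero[OF pK] by (simp add: star_diff algebra_simps)
  then have "star p = p"
    by (metis star_mult star_star)
  then show ?thesis
    using that[OF pK] zero by (simp add: star_diff algebra_simps)
qed

text \<open>The eigenspace of left multiplication by a non-scalar element is a right ideal that contains
  a nonzero vector but not \<open>1\<close>.\<close>

lemma nontrivial_projection_exists:
  assumes "\<not> (\<forall>x :: 'b. \<exists>a. x = a *\<^sub>C 1)"
  obtains p :: 'b where "star p = p" "p * p = p" "p \<noteq> 0" "p \<noteq> 1"
proof -
  obtain x :: 'b where x: "\<And>a. x \<noteq> a *\<^sub>C 1"
    using assms by blast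
  obtain a y where y: "y \<noteq> 0" "x * y = a *\<^sub>C y"
    using left_eigenvector_exists[of x] by blast
  define K where "K = {k. x * k = a *\<^sub>C k}"
  have K: "x * k = a *\<^sub>C k" if "k \<in> K" for k
    using that by (simp add: K_def)
  have "complex_vector.subspace K"
  proof (rule complex_vector.subspaceI)
    show "0 \<in> K"
      by (simp add: K_def)
    show "k + k' \<in> K" if "k \<in> K" "k' \<in> K" for k k'
      using K[OF that(1)] K[OF that(2)]
      by (simp add: K_def distrib_left complex_vector.scale_right_distrib)
    show "c *\<^sub>C k \<in> K" if "k \<in> K" for c k
      using K[OF that] by (simp add: K_def mult_scaleC_right mult.commute)
  qed
  moreover have "k * b \<in> K" if "k \<in> K" for k b
    using K[OF that] by (simp add: K_def mult_scaleC_left flip: mult.assoc)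
  ultimately obtain p where p: "p \<in> K" "star p = p" "\<And>k. k \<in> K \<Longrightarrow> p * k = k"
    using right_ideal_is_principal by blast
  have "p \<noteq> 0"
    using p(3)[of y] y by (auto simp add: K_def)
  moreover have "p \<noteq> 1"
    using K[OF p(1)] x by auto
  ultimately show ?thesis
    using that p by blast
qed

definition orthonormal_basis :: "'b set \<Rightarrow> bool"
  where "orthonormal_basis E \<longleftrightarrow> orthonormal E \<and> complex_vector.span E = UNIV"

lemma orthonormal_basis_exists: obtains E where "orthonormal_basis E"
  using orthonormal_basis_of_subspace[OF complex_vector.subspace_UNIV]
  unfolding orthonormal_basis_def by blast

lemma basis_expansion: "orthonormal_basis E \<Longrightarrow> (\<Sum>e\<in>E. ip \<psi> e x *\<^sub>C e) = x"
  using proj_on_span[of E x] by (simp add: orthonormal_basis_def proj_on_def)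

lemma parseval: "orthonormal_basis E \<Longrightarrow> (\<Sum>e\<in>E. ip \<psi> x e * ip \<psi> e y) = ip \<psi> x y"
  using arg_cong[OF basis_expansion[of E y], of "ip \<psi> x"]
  by (simp add: ip_sum_right ip_scale_right mult.commute)


section \<open>The comultiplication in an orthonormal basis\<close>

lemma cbilinear_cnj_ip: "cbilinear (\<lambda>x y. cnj (ip \<psi> x x' * ip \<psi> y y'))"
  by (rule cbilinearI)
    (simp_all add: ip_cnj ip_add_right ip_scale_right scaleC_complex_def algebra_simps)

text \<open>This removes the two conjugations in the definition of the inner product of tensors, so that
  its linearity in the second argument can be read off from the summands.\<close>

lemma cnj_tensor_lift_cnj:
  "cnj (tensor_lift (\<lambda>x y. cnj (\<beta> x y)) s) = (\<Sum>z\<in>#rep_tensor s. \<beta> (fst z) (snd z))"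
proof -
  have "cnj (\<Sum>z\<in>#M. cnj (\<beta> (fst z) (snd z))) = (\<Sum>z\<in>#M. \<beta> (fst z) (snd z))" for M
    by (induction M) simp_all
  then show ?thesis
    by (simp add: tensor_lift_def case_prod_unfold)
qed

lemma cbilinear_tensor_ip:
  "cbilinear (\<lambda>x' y'. cnj (tensor_lift (\<lambda>x y. cnj (ip \<psi> x x' * ip \<psi> y y')) s))"
  unfolding cnj_tensor_lift_cnj
  by (rule cbilinearI)
    (simp_all add: ip_add_right ip_scale_right scaleC_complex_def distrib_left distrib_right
      sum_mset.distrib sum_mset_distrib_left mult.assoc mult.left_commute)

lemma clinear_tensor_ip: "clinear (tensor_ip \<psi> s)"
  unfolding tensor_ip_def using clinear_tensor_lift[OF cbilinear_tensor_ip] .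

lemma tensor_ip_pair_right:
  "tensor_ip \<psi> s (x' \<otimes> y') = cnj (tensor_lift (\<lambda>x y. cnj (ip \<psi> x x' * ip \<psi> y y')) s)"
  unfolding tensor_ip_def by (rule tensor_lift_pair[OF cbilinear_tensor_ip])

lemma tensor_ip_pair: "tensor_ip \<psi> (x \<otimes> y) (x' \<otimes> y') = ip \<psi> x x' * ip \<psi> y y'"
  by (simp only: tensor_ip_pair_right tensor_lift_pair[OF cbilinear_cnj_ip] complex_cnj_cnj)

text \<open>The products \<open>e \<otimes> e'\<close> form an orthonormal basis of \<open>B \<otimes> B\<close>. The expansion
  yields nondegeneracy of the inner product and with it the uniqueness of adjoints.\<close>

lemma tensor_basis_expansion:
  assumes "orthonormal_basis E"
  shows "(\<Sum>e\<in>E. \<Sum>e'\<in>E. tensor_ip \<psi> (e \<otimes> e') t *\<^sub>C (e \<otimes> e')) = t"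
proof (rule clinear_tensor_eqI[of "\<lambda>t. \<Sum>e\<in>E. \<Sum>e'\<in>E. tensor_ip \<psi> (e \<otimes> e') t *\<^sub>C (e \<otimes> e')" "\<lambda>t. t"])
  note lin = clinear_add[OF clinear_tensor_ip] clinear_scale[OF clinear_tensor_ip]
  show "clinear (\<lambda>t. \<Sum>e\<in>E. \<Sum>e'\<in>E. tensor_ip \<psi> (e \<otimes> e') t *\<^sub>C (e \<otimes> e'))"
    by (rule clinearI) (simp_all add: lin scaleC_complex_def complex_vector.scale_left_distrib
        sum.distrib complex_vector.scale_sum_right)
  show "clinear (\<lambda>t :: ('b, 'b) tensor. t)"
    by (rule clinearI) simp_all
  fix x y
  note pair_lin = clinear_sum[OF cbilinear_left[OF cbilinear_tensor_pair]]
    clinear_scale[OF cbilinear_left[OF cbilinear_tensor_pair]]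
    clinear_sum[OF cbilinear_right[OF cbilinear_tensor_pair]]
    clinear_scale[OF cbilinear_right[OF cbilinear_tensor_pair]]
  have "x \<otimes> y = (\<Sum>e\<in>E. ip \<psi> e x *\<^sub>C e) \<otimes> (\<Sum>e\<in>E. ip \<psi> e y *\<^sub>C e)"
    by (simp add: basis_expansion[OF assms])
  also have "\<dots> = (\<Sum>e\<in>E. \<Sum>e'\<in>E. tensor_ip \<psi> (e \<otimes> e') (x \<otimes> y) *\<^sub>C (e \<otimes> e'))"
    by (simp only: pair_lin tensor_ip_pair complex_vector.scale_sum_right scaleC_scaleC)
      (subst sum.swap, simp only: mult.commute)
  finally show "(\<Sum>e\<in>E. \<Sum>e'\<in>E. tensor_ip \<psi> (e \<otimes> e') (x \<otimes> y) *\<^sub>C (e \<otimes> e')) = x \<otimes> y" ..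
qed

lemma tensor_ip_nondegenerate:
  assumes "\<And>x y. tensor_ip \<psi> (x \<otimes> y) s = tensor_ip \<psi> (x \<otimes> y) t"
  shows "s = t"
proof -
  obtain E where E: "orthonormal_basis E"
    by (rule orthonormal_basis_exists)
  show ?thesis
    by (subst (1 2) tensor_basis_expansion[OF E, symmetric]) (simp only: assms)
qed

text \<open>Moving factors around under the trace turns the right-hand side into Parseval's sum for
  \<open>\<langle>b y\<^sup>* | a\<^sup>* x\<rangle>\<close>. The identity says that \<open>\<Sum> x e\<^sup>* \<otimes> e y\<close> represents the functional
  \<open>a \<otimes> b \<mapsto> \<langle>a b | x y\<rangle>\<close>.\<close>

lemma ip_mult_expansion:
  assumes "orthonormal_basis E"
  shows "ip \<psi> (a * b) (x * y) = (\<Sum>e\<in>E. ip \<psi> a (x * star e) * ip \<psi> b (e * y))"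
proof -
  have "ip \<psi> a (x * star e) = ip \<psi> e (star a * x)" for e
    using psi_comm[of "star a * x" "star e"] by (simp only: ip_def mult.assoc)
  moreover have "ip \<psi> b (e * y) = ip \<psi> (b * star y) e" for e
    using psi_comm[of "star b * e" y] by (simp only: ip_def mult.assoc star_mult star_star)
  moreover have "ip \<psi> (a * b) (x * y) = ip \<psi> (b * star y) (star a * x)"
    using psi_comm[of "star b * star a * x" y]
    by (simp only: ip_def star_mult star_star mult.assoc)
  ultimately show ?thesis
    using parseval[OF assms, of "b * star y" "star a * x"] by (simp add: mult.commute)
qed

lemma adjoint_wrt_eqI:
  assumes "\<And>x y. h (T x) y = g x (S y)" and "\<And>y z. (\<And>x. g x y = g x z) \<Longrightarrow> y = z"
  shows "adjoint_wrt g h T = S"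
  unfolding adjoint_wrt_def
proof (rule the_equality)
  show "\<forall>x y. h (T x) y = g x (S y)"
    using assms(1) by blast
next
  fix S' assume "\<forall>x y. h (T x) y = g x (S' y)"
  then show "S' = S"
    using assms by (intro ext) metis
qed

text \<open>Both sides are antilinear in \<open>s\<close>; their conjugates are compared on pure tensors.\<close>

lemma tensor_mult_adjoint:
  assumes "orthonormal_basis E"
  shows "ip \<psi> (tensor_mult s) x = tensor_ip \<psi> s (\<Sum>e\<in>E. (x * star e) \<otimes> e)"
proof -
  define F where "F s = (\<Sum>e\<in>E. tensor_lift (\<lambda>a b. cnj (ip \<psi> a (x * star e) * ip \<psi> b e)) s)" for s
  note lin = clinear_tensor_lift[OF cbilinear_cnj_ip]
  have "clinear F"
    unfolding F_def
    by (rule clinearI)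
      (simp_all add: clinear_add[OF lin] clinear_scale[OF lin] sum.distrib
        complex_vector.scale_sum_right del: complex_cnj_mult)
  moreover have "clinear (\<lambda>s. ip \<psi> x (tensor_mult s))"
    by (rule clinearI) (simp_all add: clinear_add[OF clinear_tensor_mult]
        clinear_scale[OF clinear_tensor_mult] ip_add_right ip_scale_right scaleC_complex_def)
  moreover have "ip \<psi> x (tensor_mult (a \<otimes> b)) = F (a \<otimes> b)" for a b
  proof -
    have "F (a \<otimes> b) = (\<Sum>e\<in>E. cnj (ip \<psi> a (x * star e) * ip \<psi> b e))"
      by (simp only: F_def tensor_lift_pair[OF cbilinear_cnj_ip])
    then show ?thesis
      using arg_cong[OF ip_mult_expansion[OF assms, of a b x 1], of cnj]
      by (simp add: tensor_mult_pair ip_cnj)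
  qed
  ultimately have "ip \<psi> x (tensor_mult s) = F s"
    using clinear_tensor_eqI[of "\<lambda>s. ip \<psi> x (tensor_mult s)" F] by blast
  then have "ip \<psi> (tensor_mult s) x = cnj (F s)"
    by (metis ip_cnj)
  then show ?thesis
    by (simp add: F_def clinear_sum[OF clinear_tensor_ip] tensor_ip_pair_right)
qed

lemma comult_eq:
  assumes "orthonormal_basis E"
  shows "comult \<psi> x = (\<Sum>e\<in>E. (x * star e) \<otimes> e)"
proof -
  have "comult \<psi> = (\<lambda>x. \<Sum>e\<in>E. (x * star e) \<otimes> e)"
    unfolding comult_def
    by (intro adjoint_wrt_eqI tensor_mult_adjoint[OF assms] tensor_ip_nondegenerate)
  then show ?thesis by simp
qed

text \<open>The extra freedom of splitting the argument as a product is what produces the factors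
  \<open>A(p e\<^sup>*) A(e p)\<close> in \<open>(A \<bullet> A)(p)\<close>, which are adjoint to each other.\<close>

lemma comult_mult:
  assumes "orthonormal_basis E"
  shows "comult \<psi> (x * y) = (\<Sum>e\<in>E. (x * star e) \<otimes> (e * y))"
proof (rule tensor_ip_nondegenerate)
  fix a b
  have "tensor_ip \<psi> (a \<otimes> b) (comult \<psi> (x * y)) = ip \<psi> (a * b) (x * y)"
    by (simp add: comult_eq[OF assms] tensor_mult_pair flip: tensor_mult_adjoint[OF assms])
  then show "tensor_ip \<psi> (a \<otimes> b) (comult \<psi> (x * y))
      = tensor_ip \<psi> (a \<otimes> b) (\<Sum>e\<in>E. (x * star e) \<otimes> (e * y))"
    by (simp add: clinear_sum[OF clinear_tensor_ip] tensor_ip_pair ip_mult_expansion[OF assms])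
qed

lemma schur_mult:
  assumes "orthonormal_basis E" "clinear S" "clinear T"
  shows "schur \<psi> S T (x * y)
    = complex_of_real (inverse ((delta \<psi>)\<^sup>2)) *\<^sub>C (\<Sum>e\<in>E. S (x * star e) * T (e * y))"
  by (simp add: schur_def comult_mult[OF assms(1)] clinear_sum[OF clinear_tensor_map[OF assms(2,3)]]
      clinear_sum[OF clinear_tensor_mult] tensor_map_pair[OF assms(2,3)] tensor_mult_pair)

lemma clinear_schur:
  assumes "clinear S" "clinear T"
  shows "clinear (schur \<psi> S T)"
proof -
  obtain E where "orthonormal_basis E"
    by (rule orthonormal_basis_exists)
  from schur_mult[OF this assms, of _ 1] have "schur \<psi> S T = (\<lambda>x. complex_of_real (inverse ((delta \<psi>)\<^sup>2))
      *\<^sub>C (\<Sum>e\<in>E. S (x * star e) * T e))"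
    by (intro ext) simp
  then show ?thesis
    by (intro clinearI)
      (simp_all add: distrib_right clinear_add[OF assms(1)] clinear_scale[OF assms(1)] sum.distrib
        mult_scaleC_left complex_vector.scale_right_distrib complex_vector.scale_sum_right mult.commute)
qed

lemma tensor_mult_comult:
  "orthonormal_basis E \<Longrightarrow> tensor_mult (comult \<psi> x) = x * (\<Sum>e\<in>E. star e * e)"
  by (simp add: comult_eq clinear_sum[OF clinear_tensor_mult] tensor_mult_pair sum_distrib_left mult.assoc)

text \<open>By \<open>m m\<^sup>\<dagger>(1) = \<Sum> e\<^sup>* e\<close> and \<open>\<psi>(e\<^sup>* e) = 1\<close>, the number \<open>\<delta>\<^sup>2\<close> is the dimension of \<open>B\<close>.\<close>

lemma delta_form_square:
  assumes "delta_form \<psi> \<delta>" "orthonormal_basis E"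
  shows "\<delta>\<^sup>2 = card E"
proof -
  have "(\<Sum>e\<in>E. star e * e) = complex_of_real (\<delta>\<^sup>2) *\<^sub>C 1"
    using assms(1) tensor_mult_comult[OF assms(2), of 1] by (simp add: delta_form_def)
  from arg_cong[OF this, of \<psi>] have "(\<Sum>e\<in>E. ip \<psi> e e) = complex_of_real (\<delta>\<^sup>2)"
    by (simp add: psi_simps ip_def)
  moreover have "(\<Sum>e\<in>E. ip \<psi> e e) = complex_of_real (card E)"
    using assms(2) by (simp add: orthonormal_basis_def orthonormal_def)
  ultimately show ?thesis
    by (metis of_real_eq_iff)
qed

lemma delta_square:
  assumes "delta_form \<psi> \<delta>" "orthonormal_basis E"
  shows "(delta \<psi>)\<^sup>2 = card E"
proof -
  have "\<delta>' = \<delta>" if "delta_form \<psi> \<delta>'" for \<delta>'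
    using delta_form_square[OF that assms(2)] delta_form_square[OF assms] assms(1) that
    by (metis delta_form_def power2_eq_imp_eq)
  then have "delta \<psi> = \<delta>"
    unfolding delta_def using assms(1) by (intro the_equality)
  then show ?thesis
    using delta_form_square[OF assms] by simp
qed

lemma delta_nonzero:
  assumes "delta_form \<psi> \<delta>"
  shows "delta \<psi> \<noteq> 0"
proof
  assume "delta \<psi> = 0"
  obtain E where E: "orthonormal_basis E"
    by (rule orthonormal_basis_exists)
  have "E = {}"
    using delta_square[OF assms E] \<open>delta \<psi> = 0\<close> E by (simp add: orthonormal_basis_def orthonormal_def)
  then show False
    using basis_expansion[OF E, of 1] by simp
qed


section \<open>Corners of a real quantum graph\<close>

text \<open>The number \<open>\<delta>\<^sup>2 \<psi>(p A(p))\<close> equals \<open>\<Sum> \<psi>(w\<^sub>e w\<^sub>e\<^sup>*)\<close> with \<open>w\<^sub>e = p A(p e\<^sup>*)\<close>. All summands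
  are nonnegative, so by faithfulness all \<open>w\<^sub>e\<close> vanish; the \<open>e\<^sup>*\<close> span \<open>B\<close>.\<close>

lemma corner_vanishes:
  assumes graph: "quantum_graph \<psi> A" and real: "real_graph A"
    and p: "star p = p" "p * p = p" and zero: "\<psi> (p * A p) = 0"
  shows "p * A (p * b) = 0"
proof -
  have A: "clinear A" "schur \<psi> A A = A"
    using graph by (simp_all add: quantum_graph_def)
  have star_A: "A (star x) = star (A x)" for x
  proof -
    have "involution A (star x) = A (star x)"
      using real by (simp add: real_graph_def)
    then show ?thesis
      by (simp add: involution_def star_star)
  qed
  obtain \<delta> where \<delta>: "delta_form \<psi> \<delta>"
    using graph by (auto simp: quantum_graph_def quantum_set_def)
  obtain E where E: "orthonormal_basis E"
    by (rule orthonormal_basis_exists)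
  define c where "c = complex_of_real (inverse ((delta \<psi>)\<^sup>2))"
  define w where "w e = p * A (p * star e)" for e
  have A_swap: "A (e * p) = star (A (p * star e))" for e
    using star_A[of "p * star e"] by (simp add: star_mult star_star p)
  have "A p = c *\<^sub>C (\<Sum>e\<in>E. A (p * star e) * star (A (p * star e)))"
    using schur_mult[OF E A(1) A(1), of p p] by (simp add: A(2) p A_swap c_def)
  then have "p * A p * p = c *\<^sub>C (\<Sum>e\<in>E. w e * star (w e))"
    by (simp add: w_def star_mult p mult_scaleC_right mult_scaleC_left sum_distrib_left
        sum_distrib_right mult.assoc)
  moreover have "\<psi> (p * A p * p) = 0"
    using zero psi_comm[of "p * A p" p] by (simp add: p flip: mult.assoc)
  ultimately have "(\<Sum>e\<in>E. \<psi> (w e * star (w e))) = 0"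
    using delta_nonzero[OF \<delta>] by (simp add: psi_simps c_def)
  then have sum0: "(\<Sum>e\<in>E. Re (\<psi> (w e * star (w e)))) = 0"
    by (metis Re_sum zero_complex.simps(1))
  have nonneg: "\<psi> (w e * star (w e)) \<in> \<real>\<^sub>\<ge>\<^sub>0" for e
    using psi_pos[of "star (w e)"] by (simp add: star_star)
  have w0: "w e = 0" if "e \<in> E" for e
  proof -
    have "Re (\<psi> (w e * star (w e))) = 0"
      using sum0 that nonneg E
      by (subst (asm) sum_nonneg_eq_0_iff)
        (auto simp: complex_nonneg_Reals_iff orthonormal_basis_def orthonormal_def)
    then have "\<psi> (w e * star (w e)) = 0"
      using nonneg[of e] by (simp add: complex_nonneg_Reals_iff complex_eq_iff)
    then show ?thesis
      using psi_faithful[of "w e"] psi_comm[of "star (w e)" "w e"] by simp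
  qed
  have "b = star (\<Sum>e\<in>E. ip \<psi> e (star b) *\<^sub>C e)"
    by (simp add: basis_expansion[OF E] star_star)
  also have "\<dots> = (\<Sum>e\<in>E. cnj (ip \<psi> e (star b)) *\<^sub>C star e)"
    by (simp add: star_sum star_scaleC)
  finally have "p * A (p * b) = p * A (p * (\<Sum>e\<in>E. cnj (ip \<psi> e (star b)) *\<^sub>C star e))"
    by (rule arg_cong)
  also have "\<dots> = (\<Sum>e\<in>E. cnj (ip \<psi> e (star b)) *\<^sub>C w e)"
    by (simp add: sum_distrib_left mult_scaleC_right w_def clinear_sum[OF A(1)] clinear_scale[OF A(1)])
  finally show ?thesis
    by (simp add: w0)
qed

lemma schur_corner_vanishes:
  assumes "clinear A" "clinear T" and "\<And>b. p * A (p * b) = 0"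
  shows "\<psi> (p * schur \<psi> A T p) = 0"
proof -
  obtain E where E: "orthonormal_basis E"
    by (rule orthonormal_basis_exists)
  have "p * schur \<psi> A T p = complex_of_real (inverse ((delta \<psi>)\<^sup>2)) *\<^sub>C (\<Sum>e\<in>E. p * A (p * star e) * T e)"
    using schur_mult[OF E assms(1,2), of p 1] by (simp add: mult_scaleC_right sum_distrib_left mult.assoc)
  then show ?thesis
    by (simp add: assms(3) psi_simps)
qed

end


section \<open>Homomorphisms to the graph \<open>K\<^sub>2\<close>\<close>

interpretation tau: faithful_trace tau
proof
  have "clinear tau"
    by (rule clinearI) (simp_all add: tau_def C2_simps scaleC_complex_def algebra_simps add_divide_distrib)
  moreover have pos: "tau (star x * x) = complex_of_real (((cmod (C2_fst x))\<^sup>2 + (cmod (C2_snd x))\<^sup>2) / 2)" for x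
    by (simp add: tau_def C2_simps complex_norm_square mult.commute del: of_real_power)
  moreover have "x = 0" if "tau (star x * x) = 0" for x
    using that unfolding pos of_real_eq_0_iff by (simp add: sum_power2_eq_zero_iff C2_simps)
  ultimately show "faithful_state tau"
    unfolding faithful_state_def by (simp add: tau_def C2_simps complex_nonneg_Reals_iff)
  show "tracial tau"
    by (simp add: tracial_def tau_def C2_simps mult.commute)
qed

text \<open>The factor \<open>\<surd>2\<close> normalizes the unit vectors, since \<open>\<tau>\<close> gives each point the weight \<open>1/2\<close>.\<close>

definition C2_basis :: "C2 set"
  where "C2_basis = {C2 (complex_of_real (sqrt 2)) 0, C2 0 (complex_of_real (sqrt 2))}"

lemma sum_C2_basis: "(\<Sum>e\<in>C2_basis. g e)
    = g (C2 (complex_of_real (sqrt 2)) 0) + g (C2 0 (complex_of_real (sqrt 2)))"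
  by (simp add: C2_basis_def)

lemma sqrt2_mult_sqrt2: "complex_of_real (sqrt 2) * complex_of_real (sqrt 2) = 2"
  by (simp flip: of_real_mult)

lemma C2_basis_orthonormal: "tau.orthonormal_basis C2_basis"
proof -
  have "tau.orthonormal C2_basis"
    by (auto simp: tau.orthonormal_def C2_basis_def ip_def tau_def C2_simps sqrt2_mult_sqrt2)
  moreover have "x \<in> complex_vector.span C2_basis" for x
  proof -
    have "x = (C2_fst x / complex_of_real (sqrt 2)) *\<^sub>C C2 (complex_of_real (sqrt 2)) 0
        + (C2_snd x / complex_of_real (sqrt 2)) *\<^sub>C C2 0 (complex_of_real (sqrt 2))"
      by (simp add: C2_simps)
    then show ?thesis
      by (metis C2_basis_def complex_vector.span_add complex_vector.span_base
          complex_vector.span_scale insertI1 insertI2)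
  qed
  ultimately show ?thesis
    by (auto simp: tau.orthonormal_basis_def)
qed

lemma delta_tau_square: "(delta tau)\<^sup>2 = 2"
proof -
  have "delta_form tau (sqrt 2)"
    by (simp add: delta_form_def tau.tensor_mult_comult[OF C2_basis_orthonormal] sum_C2_basis
        C2_simps sqrt2_mult_sqrt2 mult.commute)
  from tau.delta_square[OF this C2_basis_orthonormal] show ?thesis
    by (simp add: C2_basis_def)
qed

definition zero_diagonal :: "(C2 \<Rightarrow> C2) \<Rightarrow> bool"
  where "zero_diagonal S \<longleftrightarrow> C2_fst (S (C2 1 0)) = 0 \<and> C2_snd (S (C2 0 1)) = 0"

lemma C2_decompose: "x = C2_fst x *\<^sub>C C2 1 0 + C2_snd x *\<^sub>C C2 0 1"
  by (simp add: C2_simps)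

lemma clinear_C2: "clinear S \<Longrightarrow> S x = C2_fst x *\<^sub>C S (C2 1 0) + C2_snd x *\<^sub>C S (C2 0 1)"
  by (metis C2_decompose clinear_add clinear_scale)

text \<open>Over \<open>K\<^sub>2\<close> the Schur product is the entrywise product of matrices: the factor \<open>\<delta>\<^sup>-\<^sup>2 = 1/2\<close>
  cancels the square of the normalization of the basis.\<close>

lemma schur_K2:
  assumes "clinear S"
  shows "schur tau A_K2 S x = C2 (C2_snd x * C2_fst (S (C2 0 1))) (C2_fst x * C2_snd (S (C2 1 0)))"
proof -
  have A: "clinear A_K2"
    by (rule clinearI) (simp_all add: A_K2_def C2_simps)
  define r where "r = complex_of_real (sqrt 2)"
  have r: "r * r = 2" "cnj r = r"
    by (simp_all add: r_def sqrt2_mult_sqrt2)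
  have S: "S (C2 r 0) = r *\<^sub>C S (C2 1 0)" "S (C2 0 r) = r *\<^sub>C S (C2 0 1)"
    unfolding clinear_scale[OF assms, symmetric] by (simp_all add: C2_simps)
  have "schur tau A_K2 S x = (1 / 2) *\<^sub>C (A_K2 (x * star (C2 r 0)) * S (C2 r 0) + A_K2 (x * star (C2 0 r)) * S (C2 0 r))"
    using tau.schur_mult[OF C2_basis_orthonormal A assms, of x 1]
    by (simp add: sum_C2_basis delta_tau_square r_def)
  also have "\<dots> = C2 (r * r / 2 * (C2_snd x * C2_fst (S (C2 0 1)))) (r * r / 2 * (C2_fst x * C2_snd (S (C2 1 0))))"
    by (simp add: S r(2) A_K2_def C2_simps)
  finally show ?thesis
    by (simp add: r)
qed

lemma schur_K2_fixed_iff: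
  assumes "clinear S"
  shows "schur tau A_K2 S = S \<longleftrightarrow> zero_diagonal S"
proof
  assume *: "schur tau A_K2 S = S"
  show "zero_diagonal S"
    using schur_K2[OF assms, of "C2 1 0"] schur_K2[OF assms, of "C2 0 1"]
    by (simp add: * zero_diagonal_def C2_eq_iff)
next
  assume "zero_diagonal S"
  then have "schur tau A_K2 S x = S x" for x
    unfolding clinear_C2[OF assms, of x] by (simp add: schur_K2[OF assms] zero_diagonal_def C2_simps)
  then show "schur tau A_K2 S = S" ..
qed

lemma quantum_relation_K2:
  assumes "clinear S"
  shows "S \<in> quantum_relation tau A_K2 \<longleftrightarrow> zero_diagonal S"
proof
  assume "S \<in> quantum_relation tau A_K2"
  then obtain T where "clinear T" "S = schur tau A_K2 T"
    by (auto simp: quantum_relation_def)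
  then show "zero_diagonal S"
    by (simp add: zero_diagonal_def schur_K2)
next
  assume "zero_diagonal S"
  then have "S = schur tau A_K2 S"
    using schur_K2_fixed_iff[OF assms] by simp
  then show "S \<in> quantum_relation tau A_K2"
    unfolding quantum_relation_def using assms by blast
qed

lemma C2_hom_projections:
  assumes "unital_star_hom f"
  shows "star (f (C2 1 0)) = f (C2 1 0)" "f (C2 1 0) * f (C2 1 0) = f (C2 1 0)"
    and "star (f (C2 0 1)) = f (C2 0 1)" "f (C2 0 1) * f (C2 0 1) = f (C2 0 1)"
    and "f (C2 1 0) + f (C2 0 1) = 1" "f (C2 1 0) * f (C2 0 1) = 0" "f (C2 0 1) * f (C2 1 0) = 0"
proof -
  have f: "clinear f" "f 1 = 1" "\<And>x y. f x * f y = f (x * y)" "\<And>x. star (f x) = f (star x)"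
    using assms by (simp_all add: unital_star_hom_def)
  show "star (f (C2 1 0)) = f (C2 1 0)" "f (C2 1 0) * f (C2 1 0) = f (C2 1 0)"
    "star (f (C2 0 1)) = f (C2 0 1)" "f (C2 0 1) * f (C2 0 1) = f (C2 0 1)"
    by (simp_all add: f star_C2_def times_C2_def)
  have "f (C2 1 0) + f (C2 0 1) = f (C2 1 1)"
    by (simp add: plus_C2_def flip: clinear_add[OF f(1)])
  then show "f (C2 1 0) + f (C2 0 1) = 1"
    using f(2) by (simp add: one_C2_def)
  show "f (C2 1 0) * f (C2 0 1) = 0" "f (C2 0 1) * f (C2 1 0) = 0"
    using clinear_zero[OF f(1)] by (simp_all add: f(3) times_C2_def zero_C2_def)
qed

lemma inj_C2_hom_iff:
  assumes "unital_star_hom f"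
  shows "inj f \<longleftrightarrow> f (C2 1 0) \<noteq> 0 \<and> f (C2 0 1) \<noteq> 0"
proof
  have lin: "clinear f"
    using assms by (simp add: unital_star_hom_def)
  show "f (C2 1 0) \<noteq> 0 \<and> f (C2 0 1) \<noteq> 0" if "inj f"
    using injD[OF that, of "C2 1 0" 0] injD[OF that, of "C2 0 1" 0] clinear_zero[OF lin]
    by (auto simp: C2_simps)
  assume nz: "f (C2 1 0) \<noteq> 0 \<and> f (C2 0 1) \<noteq> 0"
  show "inj f"
  proof (rule injI)
    fix x y assume "f x = f y"
    then have "f (x - y) = 0"
      by (simp add: clinear_diff[OF lin])
    then have 0: "C2_fst (x - y) *\<^sub>C f (C2 1 0) + C2_snd (x - y) *\<^sub>C f (C2 0 1) = 0"
      using clinear_C2[OF lin, of "x - y"] by simp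
    have "C2_fst (x - y) *\<^sub>C f (C2 1 0) = 0" "C2_snd (x - y) *\<^sub>C f (C2 0 1) = 0"
      using arg_cong[OF 0, of "\<lambda>z. f (C2 1 0) * z"] arg_cong[OF 0, of "\<lambda>z. f (C2 0 1) * z"]
      by (simp_all add: distrib_left mult_scaleC_right C2_hom_projections[OF assms])
    then show "x = y"
      using nz by (simp add: C2_simps)
  qed
qed

lemma C2_hom_of_projection:
  fixes p :: "'b::fd_cstar_algebra"
  assumes "star p = p" "p * p = p"
  shows "unital_star_hom (\<lambda>x. C2_fst x *\<^sub>C p + C2_snd x *\<^sub>C (1 - p))"
  unfolding unital_star_hom_def
proof (intro conjI allI)
  show "clinear (\<lambda>x. C2_fst x *\<^sub>C p + C2_snd x *\<^sub>C (1 - p))"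
    by (rule clinearI) (simp_all add: C2_simps complex_vector.scale_left_distrib
        complex_vector.scale_right_distrib add_ac)
  have q: "(1 - p) * (1 - p) = 1 - p" "p * (1 - p) = 0" "(1 - p) * p = 0" "star (1 - p) = 1 - p"
    using assms by (simp_all add: left_diff_distrib right_diff_distrib star_diff)
  fix x y
  show "C2_fst (x * y) *\<^sub>C p + C2_snd (x * y) *\<^sub>C (1 - p)
      = (C2_fst x *\<^sub>C p + C2_snd x *\<^sub>C (1 - p)) * (C2_fst y *\<^sub>C p + C2_snd y *\<^sub>C (1 - p))"
    by (simp add: distrib_left distrib_right mult_scaleC_left mult_scaleC_right q assms
        times_C2_def mult.commute)
  show "C2_fst (star x) *\<^sub>C p + C2_snd (star x) *\<^sub>C (1 - p) = star (C2_fst x *\<^sub>C p + C2_snd x *\<^sub>C (1 - p))"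
    by (simp add: star_add star_scaleC q assms star_C2_def)
qed (simp add: one_C2_def)

context faithful_trace
begin

lemma pullback_C2:
  assumes "unital_star_hom f"
  shows "pullback \<psi> tau f T x = C2 (2 * \<psi> (f (C2 1 0) * T (f x))) (2 * \<psi> (f (C2 0 1) * T (f x)))"
proof -
  have lin: "clinear f"
    using assms by (simp add: unital_star_hom_def)
  have "adjoint_wrt (ip tau) (ip \<psi>) f = (\<lambda>y. C2 (2 * \<psi> (f (C2 1 0) * y)) (2 * \<psi> (f (C2 0 1) * y)))"
  proof (rule adjoint_wrt_eqI)
    fix x y
    have "ip \<psi> (f x) y = cnj (C2_fst x) * \<psi> (f (C2 1 0) * y) + cnj (C2_snd x) * \<psi> (f (C2 0 1) * y)"
      by (subst clinear_C2[OF lin]) (simp add: ip_def star_add star_scaleC distrib_right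
          mult_scaleC_left psi_simps C2_hom_projections[OF assms])
    then show "ip \<psi> (f x) y = ip tau x (C2 (2 * \<psi> (f (C2 1 0) * y)) (2 * \<psi> (f (C2 0 1) * y)))"
      by (simp add: ip_def tau_def C2_simps)
  qed (rule tau.ip_nondegenerate)
  then show ?thesis
    by (simp add: pullback_def)
qed

lemma pullback_C2_zero_diagonal_iff:
  assumes "unital_star_hom f"
  shows "zero_diagonal (pullback \<psi> tau f T)
    \<longleftrightarrow> \<psi> (f (C2 1 0) * T (f (C2 1 0))) = 0 \<and> \<psi> (f (C2 0 1) * T (f (C2 0 1))) = 0"
  by (simp add: zero_diagonal_def pullback_C2[OF assms])

lemma clinear_pullback_C2:
  assumes "unital_star_hom f" "clinear T"
  shows "clinear (pullback \<psi> tau f T)"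
proof -
  have lin: "clinear f"
    using assms by (simp add: unital_star_hom_def)
  have C2: "C2 u v + C2 u' v' = C2 (u + u') (v + v')" "a *\<^sub>C C2 u v = C2 (a * u) (a * v)" for a u v u' v'
    by (simp_all add: plus_C2_def scaleC_C2_def)
  show ?thesis
    by (rule clinearI)
      (simp_all add: C2 pullback_C2[OF assms(1)] clinear_add[OF lin] clinear_scale[OF lin]
        clinear_add[OF assms(2)] clinear_scale[OF assms(2)] distrib_left mult_scaleC_right
        psi_simps)
qed

lemma graph_hom_K2_iff:
  assumes "clinear A"
  shows "graph_hom \<psi> A tau A_K2 f \<longleftrightarrow> unital_star_hom f \<and> zero_diagonal (pullback \<psi> tau f A)"
  using schur_K2_fixed_iff[OF clinear_pullback_C2[OF _ assms]] by (auto simp: graph_hom_def)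

lemma loc_hom_K2_iff:
  assumes "clinear A"
  shows "loc_hom \<psi> A tau A_K2 f \<longleftrightarrow> unital_star_hom f
    \<and> (\<forall>T. clinear T \<longrightarrow> zero_diagonal (pullback \<psi> tau f (schur \<psi> A T)))"
proof -
  have "pullback \<psi> tau f ` quantum_relation \<psi> A \<subseteq> quantum_relation tau A_K2
      \<longleftrightarrow> (\<forall>T. clinear T \<longrightarrow> pullback \<psi> tau f (schur \<psi> A T) \<in> quantum_relation tau A_K2)"
    unfolding quantum_relation_def[of \<psi>] by blast
  then show ?thesis
    using quantum_relation_K2[OF clinear_pullback_C2[OF _ clinear_schur[OF assms]]]
    by (auto simp: loc_hom_def)
qed

text \<open>From right to left, \<open>A\<close> itself belongs to the quantum relation because \<open>A \<bullet> A = A\<close>. From left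
  to right, a zero diagonal makes both corners vanish on all of \<open>B\<close>, a property that passes from
  \<open>A\<close> to \<open>A \<bullet> T\<close>.\<close>

lemma graph_hom_iff_loc_hom:
  assumes "quantum_graph \<psi> A" "real_graph A"
  shows "graph_hom \<psi> A tau A_K2 f \<longleftrightarrow> loc_hom \<psi> A tau A_K2 f"
proof -
  have A: "clinear A" "schur \<psi> A A = A"
    using assms(1) by (simp_all add: quantum_graph_def)
  show ?thesis
  proof
    assume "loc_hom \<psi> A tau A_K2 f"
    then show "graph_hom \<psi> A tau A_K2 f"
      using A by (metis loc_hom_K2_iff graph_hom_K2_iff)
  next
    assume "graph_hom \<psi> A tau A_K2 f"
    then have f: "unital_star_hom f" and
      "\<psi> (f (C2 1 0) * A (f (C2 1 0))) = 0" "\<psi> (f (C2 0 1) * A (f (C2 0 1))) = 0"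
      using pullback_C2_zero_diagonal_iff by (auto simp: graph_hom_K2_iff[OF A(1)])
    then have "f (C2 1 0) * A (f (C2 1 0) * b) = 0" "f (C2 0 1) * A (f (C2 0 1) * b) = 0" for b
      using corner_vanishes[OF assms] C2_hom_projections[OF f] by auto
    then show "loc_hom \<psi> A tau A_K2 f"
      using f A(1) schur_corner_vanishes
      by (auto simp: loc_hom_K2_iff pullback_C2_zero_diagonal_iff)
  qed
qed

text \<open>One of the two projections is \<open>1\<close>, and the vanishing of its corner is the vanishing of \<open>A\<close>.\<close>

lemma noninjective_hom_imp_edgeless:
  assumes "quantum_graph \<psi> A" "real_graph A" "graph_hom \<psi> A tau A_K2 f" "\<not> inj f"
  shows "A = (\<lambda>x. 0)"
proof -
  have lin: "clinear A"
    using assms(1) by (simp add: quantum_graph_def)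
  have f: "unital_star_hom f"
    using assms(3) by (simp add: graph_hom_def)
  have "f (C2 1 0) = 1 \<or> f (C2 0 1) = 1"
    using assms(4) C2_hom_projections(5)[OF f] by (auto simp: inj_C2_hom_iff[OF f])
  then have "\<psi> (1 * A 1) = 0"
    using assms(3) by (auto simp: graph_hom_K2_iff[OF lin] pullback_C2_zero_diagonal_iff)
  then have "1 * A (1 * b) = 0" for b
    by (intro corner_vanishes[OF assms(1,2)]) simp_all
  then show ?thesis
    by auto
qed

lemma edgeless_bipartite:
  assumes "\<not> (\<forall>x :: 'b. \<exists>a. x = a *\<^sub>C 1)"
  shows "bipartite \<psi> (\<lambda>x. 0)"
proof -
  obtain p :: 'b where p: "star p = p" "p * p = p" "p \<noteq> 0" "p \<noteq> 1"
    using nontrivial_projection_exists[OF assms] .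
  define f where "f x = C2_fst x *\<^sub>C p + C2_snd x *\<^sub>C (1 - p)" for x
  have f: "unital_star_hom f"
    unfolding f_def using C2_hom_of_projection[OF p(1,2)] .
  have "clinear (\<lambda>x :: 'b. 0 :: 'b)"
    by (rule clinearI) simp_all
  then have "graph_hom \<psi> (\<lambda>x. 0) tau A_K2 f"
    using f by (simp add: graph_hom_K2_iff pullback_C2_zero_diagonal_iff psi_simps)
  moreover have "inj f"
    using p(3,4) by (simp add: inj_C2_hom_iff[OF f] f_def)
  ultimately show ?thesis
    unfolding bipartite_def by blast
qed

end

lemma dim_eq_1_if_scalar:
  assumes "\<forall>x :: 'b::fd_cstar_algebra. \<exists>a. x = a *\<^sub>C 1"
  shows "vector_space.dim scaleC (UNIV :: 'b set) = 1"
proof -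
  have "complex_vector.span {1 :: 'b} = UNIV"
    using assms by (auto simp: complex_vector.span_singleton)
  then show ?thesis
    using complex_vector.dim_eq_card[of "{1 :: 'b}" UNIV] by simp
qed

theorem theorem4p13:
  fixes \<psi> :: "'b::fd_cstar_algebra \<Rightarrow> complex" and A :: "'b \<Rightarrow> 'b"
  assumes "quantum_graph \<psi> A"
    and "real_graph A"
    and "tracial \<psi>"
    and not_one_vertex_edgeless: "\<not> (vector_space.dim scaleC (UNIV :: 'b set) = 1 \<and> A = (\<lambda>x. 0))"
  shows "bipartite \<psi> A \<longleftrightarrow> loc_2_colorable \<psi> A"
proof -
  interpret faithful_trace \<psi>
    using assms by unfold_locales (simp_all add: quantum_graph_def quantum_set_def)
  show ?thesis
  proof
    assume "bipartite \<psi> A"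
    then show "loc_2_colorable \<psi> A"
      using graph_hom_iff_loc_hom[OF assms(1,2)] by (auto simp: bipartite_def loc_2_colorable_def)
  next
    assume "loc_2_colorable \<psi> A"
    then obtain f where f: "graph_hom \<psi> A tau A_K2 f"
      using graph_hom_iff_loc_hom[OF assms(1,2)] by (auto simp: loc_2_colorable_def)
    show "bipartite \<psi> A"
    proof (cases "inj f")
      case True
      then show ?thesis
        using f by (auto simp: bipartite_def)
    next
      case False
      then have "A = (\<lambda>x. 0)"
        using noninjective_hom_imp_edgeless[OF assms(1,2) f] by simp
      then show ?thesis
        using edgeless_bipartite dim_eq_1_if_scalar not_one_vertex_edgeless by blast
    qed
  qed
qed

end
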